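(* Let $\bar{\boldsymbol V}$, $\boldsymbol V$ be the global continuous and the sub-assembled space-time finite element spaces, let $\bar{\boldsymbol{\mathcal A}}\boldsymbol u=\bar{\boldsymbol f}$ in $\bar{\boldsymbol V}$ be the original all-at-once Backward-Euler problem, and let $\boldsymbol{\mathcal A}\boldsymbol u=\boldsymbol f$ in $\boldsymbol V$ be the sub-assembled (perturbed) space-time problem, all as defined in the context. Then: (1) The Galerkin projection of the sub-assembled space-time problem $\boldsymbol{\mathcal A}\boldsymbol u=\boldsymbol f$ onto $\bar{\boldsymbol V}$ reduces to the original problem, i.e., for all $\boldsymbol u,\boldsymbol v\in\bar{\boldsymbol V}$ (regarded as elements of $\boldsymbol V$), $\boldsymbol{\mathcal A}(\boldsymbol u,\boldsymbol v)=\bar{\boldsymbol{\mathcal A}}(\boldsymbol u,\boldsymbol v)$ and $\boldsymbol f(\boldsymbol v)=\bar{\boldsymbol f}(\boldsymbol v)$. (2) The sub-assembled operator $\boldsymbol{\mathcal A}$ on $\boldsymbol V$ is positive definite.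
   Context: **Domain and partitions.** $\Omega\subset\mathbb R^d$ is a bounded open polyhedral domain with a conforming finite element (FE) mesh $\theta$ (triangles/quadrilaterals for $d=2$, tetrahedra/hexahedra for $d=3$). $\Theta$ is a partition of $\Omega$ into subdomains $\omega$ obtained by aggregation of elements of $\theta$; $\theta_\omega=\{e\in\theta: e\subset\omega\}$ is the element partition of $\omega$. The interface is $\Gamma=\bigcup_{\omega\in\Theta}\partial\omega\setminus\partial\Omega$. The time interval $(0,T]$ is partitioned by $0=t^0<t^1<\dots<t^K=T$ into time elements $\delta_k=(t^{k-1},t^k]$ of length $|\delta_k|$. By aggregation of time elements, $0=T_0<T_1<\dots<T_N=T$ defines time subdomains $\Delta_n=(T_{n-1},T_n]$, $n=1,\dots,N$. Each $\Delta_n$ is partitioned into $K_n\ge 1$ of the given time elements, with endpoints $T_{n-1}=t_n^0<t_n^1<\dots<t_n^{K_n}=T_n$; write $\delta_n^k=(t_n^{k-1},t_n^k]$. Space-time subdomains are $\boldsymbol\omega_n=\omega\times\Delta_n$. **Spatial spaces and forms.** $\bar V\subset H^1_0(\Omega)$ is the $H^1$-conforming FE space associated with $\theta$ (homogeneous Dirichlet conditions imposed strongly). $V_\omega$ is the FE space of the same type on $\theta_\omega$ with homogeneous Dirichlet conditions on $\partial\omega\cap\partial\Omega$. $V=\prod_{\omega\in\Theta}V_\omega$, and $\bar V$ is identified with the subspace of functions of $V$ that are continuous across $\Gamma$. With $\nu>0$ constant, for $u,v\in V_\omega$, $$\mathcal M_\omega(u,v)=\int_\omega uv,\qquad \mathcal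 K_\omega(u,v)=\int_\omega \nu\nabla u\cdot\nabla v,$$ and for $u,v\in\bar V$, $\bar{\mathcal M}(u,v)=\int_\Omega uv$, $\bar{\mathcal K}(u,v)=\int_\Omega\nu\nabla u\cdot\nabla v$. An operator $\mathcal A$ and its form are related by $\mathcal A(u,v)=\langle\mathcal A u,v\rangle$. **Original problem.** $\bar{\boldsymbol V}$ is the space of tuples $\boldsymbol u=(u(t^0),u(t^1),\dots,u(t^K))\in[\bar V]^{K+1}$ with $u(t^0)=0$. Given $\bar f(t^k)\in\bar V'$, $k=1,\dots,K$ (nonzero initial data is absorbed into the right-hand side at $t^1$), the original problem is the Backward-Euler system $$\bar{\mathcal M}(u(t^k)-u(t^{k-1}),v)+|\delta_k|\,\bar{\mathcal K}(u(t^k),v)=|\delta_k|\,\bar f(t^k)(v)\quad\forall v\in\bar V,\ k=1,\dots,K,$$ with $u(t^0)=0$, written compactly as $\bar{\boldsymbol{\mathcal A}}\boldsymbol u=\bar{\boldsymbol f}$ in $\bar{\boldsymbol V}$, where for $\boldsymbol u,\boldsymbol v\in\bar{\boldsymbol V}$ $$\bar{\boldsymbol{\mathcal A}}(\boldsymbol u,\boldsymbol v)=\sum_{k=1}^K\left\{\bar{\mathcal M}(u(t^k)-u(t^{k-1}),v(t^k))+|\delta_k|\bar{\mathcal K}(u(t^k),v(t^k))\right\},\quad \bar{\boldsymbol f}(\boldsymbol v)=\sum_{k=1}^K|\delta_k|\bar f(t^k)(v(t^k)).$$ **Sub-assembled problem.** For each $\boldsymbol\omega_n$, $\boldsymbol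 V_{\boldsymbol\omega_n}=[V_\omega]^{K_n+1}$ consists of tuples $\boldsymbol u_{\boldsymbol\omega_n}=(u_\omega(t_n^0),\dots,u_\omega(t_n^{K_n}))$, where for $n=1$ the zero initial condition $u_\omega(t_1^0)=0$ is imposed. The sub-assembled space is $\boldsymbol V=\prod_{n=1}^N\prod_{\omega\in\Theta}\boldsymbol V_{\boldsymbol\omega_n}$; its elements have duplicated, independent values $u_\omega(t_n^{K_n})$ and $u_\omega(t_{n+1}^0)$ at $T_n$ for $n=1,\dots,N-1$. $\bar{\boldsymbol V}$ is identified with the subspace of $\boldsymbol V$ of functions that are continuous across $\Gamma$ at every time value and continuous in time at the time interfaces, i.e. $u_\omega(t_{n-1}^{K_{n-1}})=u_\omega(t_n^0)$ for all $\omega\in\Theta$, $n=2,\dots,N$. The sub-assembled problem $\boldsymbol{\mathcal A}\boldsymbol u=\boldsymbol f$ in $\boldsymbol V$ reads: find $\boldsymbol u\in\boldsymbol V$ with $\boldsymbol{\mathcal A}_{\boldsymbol\omega_n}(\boldsymbol u_{\boldsymbol\omega_n},\boldsymbol v_{\boldsymbol\omega_n})=\boldsymbol f_{\boldsymbol\omega_n}(\boldsymbol v_{\boldsymbol\omega_n})$ for every $\boldsymbol\omega_n$ and every $\boldsymbol v\in\boldsymbol V$, where $$\boldsymbol{\mathcal A}_{\boldsymbol\omega_n}(\boldsymbol u_{\boldsymbol\omega_n},\boldsymbol v_{\boldsymbol\omega_n})=\sum_{k=1}^{K_n}\left\{\mathcal M_\omega(u_\omega(t_n^k)-u_\omega(t_n^{k-1}),v_\omega(t_n^k))+|\delta_n^k|\,\mathcal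 K_\omega(u_\omega(t_n^k),v_\omega(t_n^k))\right\}$$ $$\qquad+\frac{1-\mathrm{Kr}_{1,n}}{2}\mathcal M_\omega(u_\omega(t_n^0),v_\omega(t_n^0))-\frac{1-\mathrm{Kr}_{N,n}}{2}\mathcal M_\omega(u_\omega(t_n^{K_n}),v_\omega(t_n^{K_n})),$$ $$\boldsymbol f_{\boldsymbol\omega_n}(\boldsymbol v_{\boldsymbol\omega_n})=\sum_{k=1}^{K_n}|\delta_n^k|\,f_\omega(t_n^k)(v_\omega(t_n^k)),$$ $\mathrm{Kr}_{i,j}$ is the Kronecker delta, and $f_\omega(t)\in V_\omega'$ are subdomain contributions of the source term, so that $\sum_{\omega\in\Theta}f_\omega(t)(v_\omega)=\bar f(t)(v)$ for $v\in\bar V$. The global form and functional on $\boldsymbol V$ are $$\boldsymbol{\mathcal A}(\boldsymbol u,\boldsymbol v)=\sum_{n=1}^N\sum_{\omega\in\Theta}\boldsymbol{\mathcal A}_{\boldsymbol\omega_n}(\boldsymbol u_{\boldsymbol\omega_n},\boldsymbol v_{\boldsymbol\omega_n}),\qquad \boldsymbol f(\boldsymbol v)=\sum_{n=1}^N\sum_{\omega\in\Theta}\boldsymbol f_{\boldsymbol\omega_n}(\boldsymbol v_{\boldsymbol\omega_n}).$$ The Galerkin projection of a form or problem on $\boldsymbol V$ onto a subspace is its restriction to trial and test functions in that subspace.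
   Formalization: Part (2) fails if N≥3 and a component of a subdomain misses ∂Ω (a constant there on an intermediate Δ_n has zero energy); proved instead: A is semidefinite with exactly these modes as null vectors, and positive definite if N≤2 or every component of every subdomain meets ∂Ω. *)

theory Defs
  imports "HOL-Analysis.Analysis" "HOL-Library.Disjoint_Sets"
begin

section \<open>Meshes and Lagrangian finite element spaces\<close>

datatype cell = Simplex | Cube

fun ref_cell :: "cell \<Rightarrow> (real ^ 'd) set" where
  "ref_cell Simplex = {x. (\<forall>i. 0 \<le> x $ i) \<and> (\<Sum>i\<in>UNIV. x $ i) \<le> 1}"
| "ref_cell Cube = {x. \<forall>i. 0 \<le> x $ i \<and> x $ i \<le> 1}"

fun exponents :: "cell \<Rightarrow> nat \<Rightarrow> ('d::finite \<Rightarrow> nat) set" where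
  "exponents Simplex p = {a. (\<Sum>i\<in>UNIV. a i) \<le> p}"
| "exponents Cube p = {a. \<forall>i. a i \<le> p}"

text \<open>Total degree at most \<open>p\<close> on simplices, degree at most \<open>p\<close> in each variable on cubes.\<close>

definition poly_space :: "cell \<Rightarrow> nat \<Rightarrow> (real ^ 'd \<Rightarrow> real) set" where
  "poly_space c p =
    {q. \<exists>coef :: ('d \<Rightarrow> nat) \<Rightarrow> real.
          q = (\<lambda>x. \<Sum>a\<in>exponents c p. coef a * (\<Prod>i\<in>UNIV. x $ i ^ a i))}"

text \<open>An element is a reference cell with a geometric map defined on it: affine for triangles and
  tetrahedra, multilinear for quadrilaterals and hexahedra.\<close>

type_synonym 'd element = "cell \<times> (real ^ 'd \<Rightarrow> real ^ 'd)"

definition valid_element :: "'d::finite element \<Rightarrow> bool" where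
  "valid_element e \<longleftrightarrow>
     (\<forall>i. (\<lambda>x. snd e x $ i) \<in> poly_space (fst e) 1) \<and>
     inj_on (snd e) (ref_cell (fst e)) \<and>
     (\<forall>x\<in>ref_cell (fst e). det (matrix (frechet_derivative (snd e) (at x))) \<noteq> 0)"

definition region :: "'d::finite element \<Rightarrow> (real ^ 'd) set" where
  "region e = snd e ` ref_cell (fst e)"

definition patch :: "'d::finite element set \<Rightarrow> (real ^ 'd) set" where
  "patch E = (\<Union>e\<in>E. region e)"

text \<open>A set \<open>E\<close> of elements stands for the closed set \<open>patch E\<close>; the corresponding open
  subdomain is its interior.\<close>

definition subdom :: "'d::finite element set \<Rightarrow> (real ^ 'd) set" where
  "subdom E = interior (patch E)"

text \<open>Distinct elements meet in a common proper face, possibly empty.\<close>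

definition conforming :: "'d::finite element set \<Rightarrow> bool" where
  "conforming \<theta> \<longleftrightarrow>
     (\<forall>e\<in>\<theta>. \<forall>e'\<in>\<theta>. e \<noteq> e' \<longrightarrow>
        (\<exists>f f'. f face_of ref_cell (fst e) \<and> f \<noteq> ref_cell (fst e) \<and>
                f' face_of ref_cell (fst e') \<and> f' \<noteq> ref_cell (fst e') \<and>
                region e \<inter> region e' = snd e ` f \<and>
                region e \<inter> region e' = snd e' ` f'))"

text \<open>The condition \<open>interior (closure \<Omega>) = \<Omega>\<close> excludes domains with slits.\<close>

definition polyhedral_domain :: "(real ^ 'd) set \<Rightarrow> bool" where
  "polyhedral_domain \<Omega> \<longleftrightarrow>
     open \<Omega> \<and> connected \<Omega> \<and> bounded \<Omega> \<and> \<Omega> \<noteq> {} \<and> interior (closure \<Omega>) = \<Omega> \<and>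
     (\<exists>\<P>. finite \<P> \<and> (\<forall>P\<in>\<P>. polytope P) \<and> closure \<Omega> = \<Union>\<P>)"

definition fe_mesh :: "(real ^ 'd) set \<Rightarrow> 'd::finite element set \<Rightarrow> bool" where
  "fe_mesh \<Omega> \<theta> \<longleftrightarrow>
     finite \<theta> \<and> (\<forall>e\<in>\<theta>. valid_element e) \<and> conforming \<theta> \<and> closure \<Omega> = patch \<theta>"

text \<open>Lagrangian finite element functions of order \<open>p\<close> on \<open>patch E\<close>, extended by zero outside so
  that equality in the space is equality of functions. For piecewise smooth functions continuity
  is \<open>H\<^sup>1\<close>-conformity. With \<open>E\<close> the whole mesh this is the global space, since then
  \<open>subdom E = \<Omega>\<close>.\<close>

definition fe_space :: "nat \<Rightarrow> (real ^ 'd) set \<Rightarrow> 'd::finite element set \<Rightarrow> (real ^ 'd \<Rightarrow> real) set" where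
  "fe_space p \<Omega> E =
    {u. (\<forall>x. x \<notin> patch E \<longrightarrow> u x = 0) \<and>
        continuous_on (patch E) u \<and>
        (\<forall>e\<in>E. \<exists>q\<in>poly_space (fst e) p. \<forall>x\<in>ref_cell (fst e). u (snd e x) = q x) \<and>
        (\<forall>x\<in>frontier (subdom E) \<inter> frontier \<Omega>. u x = 0)}"

definition restrict_to :: "'d::finite element set \<Rightarrow> (real ^ 'd \<Rightarrow> real) \<Rightarrow> real ^ 'd \<Rightarrow> real" where
  "restrict_to E u = (\<lambda>x. if x \<in> patch E then u x else 0)"

definition linear_functional_on :: "(real ^ 'd \<Rightarrow> real) set \<Rightarrow> ((real ^ 'd \<Rightarrow> real) \<Rightarrow> real) \<Rightarrow> bool" where
  "linear_functional_on S \<phi> \<longleftrightarrow>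
     (\<forall>u\<in>S. \<forall>v\<in>S. \<forall>a b. \<phi> (\<lambda>x. a * u x + b * v x) = a * \<phi> u + b * \<phi> v)"

section \<open>Spatial forms\<close>

text \<open>Finite element functions are differentiable in the interior of each element, so \<open>grad u\<close>
  represents the weak gradient up to the element boundaries, a null set on which its values are
  arbitrary. The integrals therefore use the completed Lebesgue measure.\<close>

definition grad :: "(real ^ 'd \<Rightarrow> real) \<Rightarrow> real ^ 'd \<Rightarrow> real ^ 'd::finite" where
  "grad u x = (\<chi> i. frechet_derivative u (at x) (axis i 1))"

definition mass_form :: "(real ^ 'd::finite) set \<Rightarrow> (real ^ 'd \<Rightarrow> real) \<Rightarrow> (real ^ 'd \<Rightarrow> real) \<Rightarrow> real" where
  "mass_form D u v = (LINT x:D|lebesgue. u x * v x)"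

definition stiffness_form ::
    "real \<Rightarrow> (real ^ 'd::finite) set \<Rightarrow> (real ^ 'd \<Rightarrow> real) \<Rightarrow> (real ^ 'd \<Rightarrow> real) \<Rightarrow> real" where
  "stiffness_form \<nu> D u v = (LINT x:D|lebesgue. \<nu> * (grad u x \<bullet> grad v x))"

section \<open>Time partition\<close>

text \<open>The time values are \<open>t 0 < \<dots> < t K\<close>; the interfaces of the time subdomains are
  \<open>T\<^sub>n = t (m n)\<close>, so that the local time values are \<open>t\<^sub>n\<^sup>k = t (m (n - 1) + k)\<close>.\<close>

definition time_partition :: "real \<Rightarrow> nat \<Rightarrow> (nat \<Rightarrow> real) \<Rightarrow> nat \<Rightarrow> (nat \<Rightarrow> nat) \<Rightarrow> bool" where
  "time_partition T K t N m \<longleftrightarrow>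
     0 < T \<and> t 0 = 0 \<and> t K = T \<and> strict_mono_on {0..K} t \<and>
     1 \<le> N \<and> m 0 = 0 \<and> m N = K \<and> strict_mono_on {0..N} m"

definition steps :: "(nat \<Rightarrow> nat) \<Rightarrow> nat \<Rightarrow> nat" where
  "steps m n = m n - m (n - 1)"

definition local_time :: "(nat \<Rightarrow> real) \<Rightarrow> (nat \<Rightarrow> nat) \<Rightarrow> nat \<Rightarrow> nat \<Rightarrow> real" where
  "local_time t m n k = t (m (n - 1) + k)"

definition Kr :: "nat \<Rightarrow> nat \<Rightarrow> real" where
  "Kr i j = (if i = j then 1 else 0)"

section \<open>Original all-at-once problem\<close>

definition st_space_bar ::
    "nat \<Rightarrow> (real ^ 'd) set \<Rightarrow> 'd::finite element set \<Rightarrow> nat \<Rightarrow> (nat \<Rightarrow> real ^ 'd \<Rightarrow> real) set" where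
  "st_space_bar p \<Omega> \<theta> K =
    {u. u 0 = (\<lambda>x. 0) \<and> (\<forall>k\<in>{1..K}. u k \<in> fe_space p \<Omega> \<theta>) \<and> (\<forall>k>K. u k = (\<lambda>x. 0))}"

definition st_form_bar ::
    "real \<Rightarrow> (real ^ 'd::finite) set \<Rightarrow> nat \<Rightarrow> (nat \<Rightarrow> real) \<Rightarrow>
     (nat \<Rightarrow> real ^ 'd \<Rightarrow> real) \<Rightarrow> (nat \<Rightarrow> real ^ 'd \<Rightarrow> real) \<Rightarrow> real" where
  "st_form_bar \<nu> \<Omega> K t u v =
    (\<Sum>k=1..K. mass_form \<Omega> (\<lambda>x. u k x - u (k - 1) x) (v k)
             + (t k - t (k - 1)) * stiffness_form \<nu> \<Omega> (u k) (v k))"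

definition st_load_bar ::
    "nat \<Rightarrow> (nat \<Rightarrow> real) \<Rightarrow> (real \<Rightarrow> (real ^ 'd \<Rightarrow> real) \<Rightarrow> real) \<Rightarrow>
     (nat \<Rightarrow> real ^ 'd \<Rightarrow> real) \<Rightarrow> real" where
  "st_load_bar K t fbar v = (\<Sum>k=1..K. (t k - t (k - 1)) * fbar (t k) (v k))"

section \<open>Sub-assembled problem\<close>

text \<open>\<open>u n \<omega> k\<close> is the value \<open>u\<^sub>\<omega>(t\<^sub>n\<^sup>k)\<close>. Outside its index range a tuple is zero.\<close>

type_synonym 'd st_fun = "nat \<Rightarrow> 'd element set \<Rightarrow> nat \<Rightarrow> real ^ 'd \<Rightarrow> real"

definition st_space ::
    "nat \<Rightarrow> (real ^ 'd) set \<Rightarrow> 'd::finite element set set \<Rightarrow> nat \<Rightarrow> (nat \<Rightarrow> nat) \<Rightarrow> 'd st_fun set" where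
  "st_space p \<Omega> \<Theta> N m =
    {u. (\<forall>n \<omega> k. if n \<in> {1..N} \<and> \<omega> \<in> \<Theta> \<and> k \<le> steps m n
                 then u n \<omega> k \<in> fe_space p \<Omega> \<omega> else u n \<omega> k = (\<lambda>x. 0)) \<and>
        (\<forall>\<omega>\<in>\<Theta>. u 1 \<omega> 0 = (\<lambda>x. 0))}"

definition local_form ::
    "real \<Rightarrow> (nat \<Rightarrow> real) \<Rightarrow> nat \<Rightarrow> (nat \<Rightarrow> nat) \<Rightarrow> nat \<Rightarrow> 'd::finite element set \<Rightarrow>
     (nat \<Rightarrow> real ^ 'd \<Rightarrow> real) \<Rightarrow> (nat \<Rightarrow> real ^ 'd \<Rightarrow> real) \<Rightarrow> real" where
  "local_form \<nu> t N m n \<omega> u v =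
    (\<Sum>k=1..steps m n.
        mass_form (subdom \<omega>) (\<lambda>x. u k x - u (k - 1) x) (v k)
        + (local_time t m n k - local_time t m n (k - 1))
            * stiffness_form \<nu> (subdom \<omega>) (u k) (v k))
    + (1 - Kr 1 n) / 2 * mass_form (subdom \<omega>) (u 0) (v 0)
    - (1 - Kr N n) / 2 * mass_form (subdom \<omega>) (u (steps m n)) (v (steps m n))"

definition local_load ::
    "(nat \<Rightarrow> real) \<Rightarrow> (nat \<Rightarrow> nat) \<Rightarrow>
     ('d element set \<Rightarrow> real \<Rightarrow> (real ^ 'd \<Rightarrow> real) \<Rightarrow> real) \<Rightarrow>
     nat \<Rightarrow> 'd::finite element set \<Rightarrow> (nat \<Rightarrow> real ^ 'd \<Rightarrow> real) \<Rightarrow> real" where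
  "local_load t m f n \<omega> v =
    (\<Sum>k=1..steps m n.
        (local_time t m n k - local_time t m n (k - 1)) * f \<omega> (local_time t m n k) (v k))"

definition st_form ::
    "real \<Rightarrow> 'd::finite element set set \<Rightarrow> (nat \<Rightarrow> real) \<Rightarrow> nat \<Rightarrow> (nat \<Rightarrow> nat) \<Rightarrow>
     'd st_fun \<Rightarrow> 'd st_fun \<Rightarrow> real" where
  "st_form \<nu> \<Theta> t N m u v = (\<Sum>n=1..N. \<Sum>\<omega>\<in>\<Theta>. local_form \<nu> t N m n \<omega> (u n \<omega>) (v n \<omega>))"

definition st_load ::
    "'d::finite element set set \<Rightarrow> (nat \<Rightarrow> real) \<Rightarrow> nat \<Rightarrow> (nat \<Rightarrow> nat) \<Rightarrow>
     ('d element set \<Rightarrow> real \<Rightarrow> (real ^ 'd \<Rightarrow> real) \<Rightarrow> real) \<Rightarrow> 'd st_fun \<Rightarrow> real" where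
  "st_load \<Theta> t N m f v = (\<Sum>n=1..N. \<Sum>\<omega>\<in>\<Theta>. local_load t m f n \<omega> (v n \<omega>))"

text \<open>The identification of the continuous space-time space with a subspace of the sub-assembled
  one: restriction to every subdomain, with interface values duplicated.\<close>

definition st_embed ::
    "'d::finite element set set \<Rightarrow> nat \<Rightarrow> (nat \<Rightarrow> nat) \<Rightarrow> (nat \<Rightarrow> real ^ 'd \<Rightarrow> real) \<Rightarrow> 'd st_fun" where
  "st_embed \<Theta> N m u =
    (\<lambda>n \<omega> k. if n \<in> {1..N} \<and> \<omega> \<in> \<Theta> \<and> k \<le> steps m n
              then restrict_to \<omega> (u (m (n - 1) + k)) else (\<lambda>x. 0))"

lemma st_embed_in_st_space:
  assumes \<Omega>: "polyhedral_domain \<Omega>" "fe_mesh \<Omega> \<theta>" and P: "partition_on \<theta> \<Theta>"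
    and T: "time_partition T K t N m" and u: "u \<in> st_space_bar p \<Omega> \<theta> K"
  shows "st_embed \<Theta> N m u \<in> st_space p \<Omega> \<Theta> N m"
proof -
  have dom: "subdom \<theta> = \<Omega>"
    using \<Omega> by (simp add: subdom_def polyhedral_domain_def fe_mesh_def)
  have zero: "(\<lambda>x. 0) \<in> fe_space p \<Omega> \<theta>"
  proof -
    have "(\<lambda>x. 0) \<in> poly_space c p" for c
      unfolding poly_space_def by (auto intro!: exI[of _ "\<lambda>_. 0"])
    then show ?thesis unfolding fe_space_def by (auto intro!: bexI[of _ "\<lambda>x. 0"])
  qed
  have mem: "u k \<in> fe_space p \<Omega> \<theta>" for k
  proof -
    consider "k = 0" | "k \<in> {1..K}" | "k > K" by fastforce
    then show ?thesis using u zero unfolding st_space_bar_def by cases auto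
  qed
  have res: "restrict_to \<omega> w \<in> fe_space p \<Omega> \<omega>"
    if w: "w \<in> fe_space p \<Omega> \<theta>" and \<omega>: "\<omega> \<in> \<Theta>" for w \<omega>
  proof -
    have sub: "\<omega> \<subseteq> \<theta>" using P \<omega> by (auto simp: partition_on_def)
    then have psub: "patch \<omega> \<subseteq> patch \<theta>" by (auto simp: patch_def)
    have "continuous_on (patch \<omega>) (restrict_to \<omega> w)"
      using w psub by (auto simp: fe_space_def restrict_to_def
          cong: continuous_on_cong intro: continuous_on_subset)
    moreover have "\<exists>q\<in>poly_space (fst e) p. \<forall>x\<in>ref_cell (fst e). restrict_to \<omega> w (snd e x) = q x"
      if "e \<in> \<omega>" for e
    proof -
      have "snd e x \<in> patch \<omega>" if "x \<in> ref_cell (fst e)" for x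
        using that \<open>e \<in> \<omega>\<close> by (auto simp: patch_def region_def)
      then show ?thesis using w sub \<open>e \<in> \<omega>\<close> by (force simp: fe_space_def restrict_to_def)
    qed
    moreover have "restrict_to \<omega> w x = 0" if "x \<in> frontier \<Omega>" for x
      using w that dom by (auto simp: fe_space_def restrict_to_def)
    ultimately show ?thesis by (auto simp: fe_space_def restrict_to_def)
  qed
  have "st_embed \<Theta> N m u 1 \<omega> 0 = (\<lambda>x. 0)" for \<omega>
    using T u by (auto simp: st_embed_def time_partition_def st_space_bar_def restrict_to_def)
  moreover have "if n \<in> {1..N} \<and> \<omega> \<in> \<Theta> \<and> k \<le> steps m n
      then st_embed \<Theta> N m u n \<omega> k \<in> fe_space p \<Omega> \<omega> else st_embed \<Theta> N m u n \<omega> k = (\<lambda>x. 0)" for n \<omega> k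
    unfolding st_embed_def using res[OF mem] by simp
  ultimately show ?thesis unfolding st_space_def by blast
qed

definition positive_definite_on :: "'d st_fun set \<Rightarrow> ('d::finite st_fun \<Rightarrow> 'd st_fun \<Rightarrow> real) \<Rightarrow> bool" where
  "positive_definite_on S B \<longleftrightarrow> (\<forall>u\<in>S. u \<noteq> (\<lambda>n \<omega> k x. 0) \<longrightarrow> 0 < B u u)"

text \<open>A subdomain without a Dirichlet condition carries constants. On a time subdomain
  \<open>1 < n < N\<close> such a constant, kept constant in time, has zero energy: the time differences
  and the gradient vanish and the two perturbation terms cancel. So the form is definite only up
  to the following functions. Subdomains are not assumed connected, hence the components.\<close>

definition floating_modes ::
    "nat \<Rightarrow> (real ^ 'd) set \<Rightarrow> 'd::finite element set set \<Rightarrow> nat \<Rightarrow> (nat \<Rightarrow> nat) \<Rightarrow> 'd st_fun set" where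
  "floating_modes p \<Omega> \<Theta> N m =
    {u \<in> st_space p \<Omega> \<Theta> N m.
       \<forall>n\<in>{1..N}. \<forall>\<omega>\<in>\<Theta>.
         (n = 1 \<or> n = N \<longrightarrow> (\<forall>k. u n \<omega> k = (\<lambda>x. 0))) \<and>
         (\<forall>k\<le>steps m n. u n \<omega> k = u n \<omega> 0) \<and>
         (\<forall>C\<in>components (patch \<omega>). u n \<omega> 0 constant_on C)}"

definition non_floating :: "(real ^ 'd) set \<Rightarrow> 'd::finite element set \<Rightarrow> bool" where
  "non_floating \<Omega> \<omega> \<longleftrightarrow> (\<forall>C\<in>components (patch \<omega>). C \<inter> frontier \<Omega> \<noteq> {})"

end

theory Submission
  imports Defs
begin

text \<open>Two mechanisms in time and one in space carry the result.

  Consistency. For a function that is continuous in time, the two perturbation terms at an interior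
  interface \<open>T\<^sub>n\<close>, one from each adjacent time subdomain, are equal up to sign and cancel
  (\<open>interface_terms_cancel\<close>); what remains is the Backward-Euler sum, cut into consecutive blocks.
  For a function that is continuous in space, the local forms add up to the forms on \<open>\<Omega>\<close>, because
  every form is a sum of integrals over the open cells of the mesh: distinct open cells are
  disjoint, and what they miss is a null set (\<open>subdom_integral_eq_sum\<close>).

  Definiteness. Polarisation of \<open>M(u\<^sub>k - u\<^sub>k\<^sub>-\<^sub>1, u\<^sub>k)\<close> produces half the squared norm of the jump
  plus a telescoping difference. The perturbation terms cancel the telescoped values at interior
  interfaces (\<open>local_form_energy\<close>), so with the initial condition each local form is a sum of squares. Its zeros are constant in time and have
  zero gradient, hence are constant on the components of the patch, and they vanish on the first
  time subdomain by the initial condition and on the last by the norm left over there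
  (\<open>local_form_definite\<close>). These are the floating modes; if there is no intermediate time subdomain,
  or if a Dirichlet condition reaches every component, only zero is left.

  The analytic input is that the gradient of a finite element function has a continuous extension from
  each open cell to the closed element (\<open>grad_extends_continuously\<close>). It makes the stiffness integrands
  integrable, so that integrals may be split, and continuous, so that a zero integral means a zero
  gradient.\<close>

section \<open>Geometry of elements\<close>

text \<open>Working with images of the open reference cell, rather than with interiors of regions, gives sets
  that are disjoint for distinct elements and on which the gradient is given by the chain rule.\<close>

definition open_cell :: "'d::finite element \<Rightarrow> (real ^ 'd) set" where
  "open_cell e = snd e ` interior (ref_cell (fst e))"

lemma ref_cell_bounds:
  assumes "x \<in> ref_cell c" shows "0 \<le> x $ i" "x $ i \<le> 1"
proof -
  have "(\<forall>i. 0 \<le> x $ i) \<and> (\<forall>i. x $ i \<le> 1)"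
  proof (cases c)
    case Simplex
    then have "\<forall>i. 0 \<le> x $ i" and s: "(\<Sum>i\<in>UNIV. x $ i) \<le> 1" using assms by auto
    moreover from this have "x $ i \<le> (\<Sum>i\<in>UNIV. x $ i)" for i
      by (intro member_le_sum) auto
    ultimately show ?thesis by (meson order_trans)
  qed (use assms in auto)
  then show "0 \<le> x $ i" "x $ i \<le> 1" by auto
qed

lemma convex_ref_cell: "convex (ref_cell c)"
proof (cases c)
  case Simplex
  have "(\<Sum>i\<in>UNIV. (u *\<^sub>R x + v *\<^sub>R y) $ i) \<le> 1"
    if "(\<Sum>i\<in>UNIV. x $ i) \<le> 1" "(\<Sum>i\<in>UNIV. y $ i) \<le> 1" "0 \<le> u" "0 \<le> v" "u + v = 1"
    for x y :: "real^'a" and u v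
    using convex_bound_le[OF that]
    by (simp add: sum.distrib sum_distrib_left)
  then show ?thesis using Simplex by (auto simp: convex_def)
next
  case Cube
  then show ?thesis by (auto simp: convex_def intro: convex_bound_le)
qed

lemma compact_ref_cell: "compact (ref_cell c :: (real ^ 'd::finite) set)"
proof -
  have "ref_cell c \<subseteq> cbox (0 :: real ^ 'd) 1"
    using ref_cell_bounds by (auto simp: mem_box_cart)
  moreover have "closed (ref_cell c :: (real ^ 'd) set)"
  proof (cases c)
    case Simplex
    then show ?thesis
      by (simp add: Collect_conj_eq Collect_all_eq)
        (intro closed_Int closed_INT closed_Collect_le continuous_intros ballI)
  next
    case Cube
    then show ?thesis
      by (simp add: Collect_conj_eq Collect_all_eq)
        (intro closed_Int closed_INT closed_Collect_le continuous_intros ballI)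
  qed
  ultimately show ?thesis
    using bounded_cbox bounded_subset compact_eq_bounded_closed by blast
qed

text \<open>Both reference cells contain the cube \<open>[0, 1/d]\<^sup>d\<close>, which has interior points.\<close>

lemma interior_ref_cell_nonempty: "interior (ref_cell c :: (real ^ 'd::finite) set) \<noteq> {}"
proof -
  define b :: "real ^ 'd" where "b = (\<chi> i. 1 / CARD('d))"
  have "cbox 0 b \<subseteq> ref_cell c"
  proof
    fix x assume "x \<in> cbox 0 b"
    then have x: "0 \<le> x $ i" "x $ i \<le> 1 / CARD('d)" for i by (auto simp: mem_box_cart b_def)
    have "(\<Sum>i\<in>UNIV. x $ i) \<le> (\<Sum>i\<in>(UNIV :: 'd set). 1 / CARD('d))" by (intro sum_mono x)
    moreover have "x $ i \<le> 1" for i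
      by (rule order_trans[OF x(2)]) (simp add: Suc_leI)
    ultimately show "x \<in> ref_cell c" using x by (cases c) auto
  qed
  then have "box 0 b \<subseteq> interior (ref_cell c)"
    by (metis interior_cbox interior_mono)
  moreover have "(\<chi> i. 1 / (2 * CARD('d))) \<in> box 0 b"
    by (auto simp: mem_box_cart b_def field_simps)
  ultimately show ?thesis by auto
qed

lemma closure_interior_ref_cell:
  "closure (interior (ref_cell c)) = (ref_cell c :: (real ^ 'd::finite) set)"
  by (simp add: convex_closure_interior[OF convex_ref_cell interior_ref_cell_nonempty]
      compact_imp_closed[OF compact_ref_cell])

text \<open>Continuity in the base point, for each fixed direction, makes the entries of the Jacobian and hence
  Cramer's formula for the gradient continuous.\<close>

lemma poly_space_has_derivative:
  assumes "q \<in> poly_space c p"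
  obtains q' where "\<And>x. (q has_derivative q' x) (at x)" "\<And>h. continuous_on UNIV (\<lambda>x. q' x h)"
proof -
  obtain coef where q: "q = (\<lambda>x. \<Sum>a\<in>exponents c p. coef a * (\<Prod>i\<in>UNIV. x $ i ^ a i))"
    using assms by (auto simp: poly_space_def)
  define q' where "q' x h = (\<Sum>a\<in>exponents c p. coef a *
      (\<Sum>i\<in>UNIV. (of_nat (a i) * h $ i * x $ i ^ (a i - 1)) * (\<Prod>j\<in>UNIV - {i}. x $ j ^ a j)))"
    for x h
  have coord: "((\<lambda>x :: real ^ 'a. x $ i) has_derivative (\<lambda>h. h $ i)) (at x)" for i x
    by (rule bounded_linear_imp_has_derivative[OF bounded_linear_vec_nth])
  have "((\<lambda>x :: real ^ 'a. x $ i ^ n) has_derivative (\<lambda>h. of_nat n * h $ i * x $ i ^ (n - 1))) (at x)"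
    for i n x
    by (rule has_derivative_power[OF coord])
  then have "(q has_derivative q' x) (at x)" for x
    unfolding q q'_def
    by (intro has_derivative_sum has_derivative_mult_right has_derivative_prod)
  moreover have "continuous_on UNIV (\<lambda>x. q' x h)" for h
    unfolding q'_def by (intro continuous_intros)
  ultimately show ?thesis using that by blast
qed

lemma valid_element_has_derivative:
  assumes "valid_element e"
  obtains F' where "\<And>x. (snd e has_derivative F' x) (at x)" "\<And>h. continuous_on UNIV (\<lambda>x. F' x h)"
proof -
  have "\<forall>i. \<exists>q'. (\<forall>x. ((\<lambda>x. snd e x $ i) has_derivative q' x) (at x)) \<and>
      (\<forall>h. continuous_on UNIV (\<lambda>x. q' x h))"
  proof
    fix i
    have "(\<lambda>x. snd e x $ i) \<in> poly_space (fst e) 1"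
      using assms by (simp add: valid_element_def)
    then obtain q' where "\<And>x. ((\<lambda>x. snd e x $ i) has_derivative q' x) (at x)"
        "\<And>h. continuous_on UNIV (\<lambda>x. q' x h)"
      by (rule poly_space_has_derivative) blast
    then show "\<exists>q'. (\<forall>x. ((\<lambda>x. snd e x $ i) has_derivative q' x) (at x)) \<and>
        (\<forall>h. continuous_on UNIV (\<lambda>x. q' x h))"
      by blast
  qed
  then obtain D where D: "\<And>i x. ((\<lambda>x. snd e x $ i) has_derivative D i x) (at x)"
      and C: "\<And>i h. continuous_on UNIV (\<lambda>x. D i x h)"
    by metis
  have "(snd e has_derivative (\<lambda>h. \<chi> i. D i x h)) (at x)" for x
    using D by (subst has_derivative_componentwise_within) (auto simp: Basis_vec_def inner_axis)
  moreover have "continuous_on UNIV (\<lambda>x. \<chi> i. D i x h)" for h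
    using C by (intro continuous_intros)
  ultimately show ?thesis using that[of "\<lambda>x h. \<chi> i. D i x h"] by blast
qed

lemma differentiable_on_geometric_map:
  assumes "valid_element e" shows "snd e differentiable_on S"
proof -
  obtain F' where "\<And>x. (snd e has_derivative F' x) (at x)"
    using assms by (rule valid_element_has_derivative) blast
  then show ?thesis
    unfolding differentiable_on_def differentiable_def by (blast intro: has_derivative_at_withinI)
qed

lemma continuous_on_geometric_map: "valid_element e \<Longrightarrow> continuous_on S (snd e)"
  by (intro differentiable_imp_continuous_on differentiable_on_geometric_map)

lemma compact_region: "valid_element e \<Longrightarrow> compact (region e)"
  unfolding region_def
  by (intro compact_continuous_image continuous_on_geometric_map compact_ref_cell)

lemma open_cell_subset_region: "open_cell e \<subseteq> region e"
  unfolding open_cell_def region_def using interior_subset by blast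

text \<open>By invariance of domain, since the geometric map is continuous and injective.\<close>

lemma open_open_cell: "valid_element e \<Longrightarrow> open (open_cell e)"
  unfolding open_cell_def
  by (intro invariance_of_domain continuous_on_geometric_map)
    (auto simp: valid_element_def intro: inj_on_subset[OF _ interior_subset])

lemma connected_open_cell: "valid_element e \<Longrightarrow> connected (open_cell e)"
  unfolding open_cell_def
  by (intro connected_continuous_image continuous_on_geometric_map convex_connected
      convex_interior convex_ref_cell)

lemma region_subset_closure_open_cell:
  assumes "valid_element e" shows "region e \<subseteq> closure (open_cell e)"
proof -
  have "snd e ` closure (interior (ref_cell (fst e))) \<subseteq> closure (open_cell e)"
    unfolding open_cell_def
    by (intro image_closure_subset continuous_on_geometric_map[OF assms] closed_closure
        closure_subset)
  then show ?thesis by (simp add: closure_interior_ref_cell region_def)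
qed

text \<open>What is missing is the image of the frontier of a convex set, which is null, under a differentiable
  map between spaces of equal dimension.\<close>

lemma negligible_region_minus_open_cell:
  assumes "valid_element e" shows "negligible (region e - open_cell e)"
proof -
  have "negligible (snd e ` frontier (ref_cell (fst e)))"
  proof (rule negligible_differentiable_image_negligible)
    show "negligible (frontier (ref_cell (fst e) :: (real ^ 'a) set))"
      by (rule negligible_convex_frontier[OF convex_ref_cell])
    show "snd e differentiable_on frontier (ref_cell (fst e))"
      by (rule differentiable_on_geometric_map[OF assms])
  qed auto
  then show ?thesis
    by (rule negligible_subset)
      (auto simp: region_def open_cell_def frontier_def compact_imp_closed[OF compact_ref_cell])
qed

text \<open>Conforming elements meet in the image of a proper face. Such a face misses the interior of the
  convex reference cell, and an injective geometric map keeps the two images apart.\<close>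

lemma open_cell_disjoint_region:
  assumes "conforming \<theta>" "e \<in> \<theta>" "e' \<in> \<theta>" "e \<noteq> e'" "valid_element e"
  shows "open_cell e \<inter> region e' = {}"
proof -
  let ?R = "ref_cell (fst e) :: (real ^ 'a) set"
  obtain f where f: "f face_of ?R" "f \<noteq> ?R" "region e \<inter> region e' = snd e ` f"
    using assms(1)[unfolded conforming_def, rule_format, OF assms(2-4)] by (elim exE conjE) 
  have "f \<inter> interior ?R = {}"
    using face_of_subset_rel_frontier[OF f(1,2)] interior_subset_rel_interior[of ?R]
    by (auto simp: rel_frontier_def)
  moreover have "f \<subseteq> ?R" using f(1) by (simp add: face_of_imp_subset)
  moreover have "inj_on (snd e) ?R" using assms(5) by (simp add: valid_element_def)
  ultimately have "snd e ` f \<inter> open_cell e = {}"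
    unfolding open_cell_def
    by (subst inj_on_image_Int[symmetric, of _ ?R]) (use interior_subset in auto)
  moreover have "open_cell e \<inter> region e' \<subseteq> snd e ` f"
    unfolding f(3)[symmetric] using open_cell_subset_region by blast
  ultimately show ?thesis by blast
qed

section \<open>Gradients of finite element functions\<close>

lemma linear_eq_sum_axis:
  fixes L :: "real ^ 'd::finite \<Rightarrow> real"
  assumes "linear L"
  shows "L v = (\<Sum>k\<in>UNIV. v $ k * L (axis k 1))"
proof -
  have "L v = L (\<Sum>k\<in>UNIV. v $ k *\<^sub>R axis k 1)"
    using basis_expansion[of v] by (simp add: scalar_mult_eq_scaleR)
  also have "\<dots> = (\<Sum>k\<in>UNIV. v $ k * L (axis k 1))"
    using assms by (simp add: linear_sum linear_scale o_def)
  finally show ?thesis .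
qed

text \<open>At a point without a derivative \<open>frechet_derivative\<close> is a choice from an empty predicate. The
  predicates of \<open>u\<close> and \<open>w\<close> coincide, so the choices do too.\<close>

lemma grad_cong_open:
  assumes "open S" "x \<in> S" "\<And>y. y \<in> S \<Longrightarrow> u y = w y"
  shows "grad u x = grad w x"
proof -
  have "(u has_derivative D) (at x) \<longleftrightarrow> (w has_derivative D) (at x)" for D
    using assms has_derivative_transform_within_open[of u D x UNIV S w]
      has_derivative_transform_within_open[of w D x UNIV S u] by auto
  then show ?thesis by (simp add: grad_def frechet_derivative_def)
qed

lemma grad_const_on_open:
  assumes "open S" "x \<in> S" "\<And>y. y \<in> S \<Longrightarrow> u y = c"
  shows "grad u x = 0"
proof -
  have "grad u x = grad (\<lambda>_. c) x" by (rule grad_cong_open[OF assms])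
  also have "\<dots> = 0" by (simp add: grad_def vec_eq_iff)
  finally show ?thesis .
qed

lemma continuous_on_det:
  fixes A :: "'a::topological_space \<Rightarrow> real ^ 'n ^ 'n"
  assumes "\<And>i j. continuous_on S (\<lambda>x. A x $ i $ j)"
  shows "continuous_on S (\<lambda>x. det (A x))"
  unfolding det_def by (intro continuous_intros assms)

text \<open>The chain rule gives the linear system \<open>transpose J * grad u = grad q\<close> with the Jacobian \<open>J\<close>
  of the geometric map; Cramer's rule then expresses \<open>grad u\<close> by a function that makes sense and is
  continuous up to the boundary of the element, where \<open>u\<close> itself need not be differentiable.\<close>

lemma grad_extends_continuously:
  fixes e :: "'d::finite element"
  assumes e: "valid_element e" and q: "q \<in> poly_space c p"
    and u: "\<And>x. x \<in> ref_cell (fst e) \<Longrightarrow> u (snd e x) = q x"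
  obtains g where "continuous_on (region e) g" "\<And>y. y \<in> open_cell e \<Longrightarrow> grad u y = g y"
    "\<And>y. y \<in> open_cell e \<Longrightarrow> u differentiable (at y)"
proof -
  define R where "R = (ref_cell (fst e) :: (real ^ 'd) set)"
  define F where "F = snd e"
  define G where "G = the_inv_into R F"
  obtain F' where F': "\<And>x. (F has_derivative F' x) (at x)" "\<And>h. continuous_on UNIV (\<lambda>x. F' x h)"
    unfolding F_def using e by (rule valid_element_has_derivative) blast
  obtain q' where q': "\<And>x. (q has_derivative q' x) (at x)" "\<And>h. continuous_on UNIV (\<lambda>x. q' x h)"
    using q by (rule poly_space_has_derivative) blast
  have inj: "inj_on F R" and det: "\<And>x. x \<in> R \<Longrightarrow> det (matrix (F' x)) \<noteq> 0"
    using e frechet_derivative_at[OF F'(1)] by (auto simp: valid_element_def R_def F_def)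
  have region: "region e = F ` R" and cell: "open_cell e = F ` interior R"
    by (auto simp: region_def open_cell_def R_def F_def)
  have G: "G (F x) = x" if "x \<in> R" for x
    unfolding G_def using inj that by (rule the_inv_into_f_f)
  have contG: "continuous_on (region e) G"
    unfolding G_def region using inj
    by (intro continuous_on_inv_into)
      (auto simp: F_def R_def intro: continuous_on_geometric_map e compact_ref_cell)
  define A where "A x = transpose (matrix (F' x))" for x
  \<comment> \<open>Cramer's rule for the system with matrix \<open>A x\<close> and the partial derivatives of \<open>q\<close> on the right.\<close>
  define H where "H x = (\<chi> k. det (\<chi> i j. if j = k then q' x (axis i 1) else A x $ i $ j) / det (A x))" for x
  have A: "A x $ i $ k = F' x (axis i 1) $ k" for x i k
    by (simp add: A_def matrix_def transpose_def)
  have contA: "continuous_on R (\<lambda>x. A x $ i $ k)" for i k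
    unfolding A by (intro continuous_on_component continuous_on_subset[OF F'(2)]) auto
  have "continuous_on R (\<lambda>x. if j = k then q' x (axis i 1) else A x $ i $ j)" for i j k
    using contA continuous_on_subset[OF q'(2)] by (cases "j = k") auto
  then have contH: "continuous_on R H"
    unfolding H_def
    by (intro continuous_on_vec_lambda continuous_on_divide continuous_on_det)
      (auto simp: A_def det contA[unfolded A_def])
  have *: "grad u (F x) = H x \<and> u differentiable (at (F x))" if x: "x \<in> interior R" for x
  proof -
    have xR: "x \<in> R" using x interior_subset by blast
    obtain B where inv: "B ** matrix (F' x) = mat 1"
      using det[OF xR] by (auto simp: invertible_det_nz[symmetric] invertible_def)
    let ?u' = "q' x \<circ> (*v) B"
    have lin: "linear (F' x)" using F'(1) has_derivative_linear by blast
    have inv': "(*v) B \<circ> F' x = id"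
    proof
      fix h
      have "F' x h = matrix (F' x) *v h" by (simp add: matrix_vector_mul(2)[OF lin, THEN fun_cong])
      then show "((*v) B \<circ> F' x) h = id h"
        by (simp add: matrix_vector_mul_assoc inv)
    qed
    have "(G has_derivative (*v) B) (at (F x))"
    proof (rule has_derivative_inverse_basic[where f = F and T = "open_cell e"])
      show "(F has_derivative F' x) (at (G (F x)))" by (simp add: G xR F')
      show "continuous (at (F x)) G"
        using contG x open_open_cell[OF e] open_cell_subset_region[of e]
        by (metis cell continuous_on_eq_continuous_at continuous_on_subset imageI)
      show "F (G z) = z" if "z \<in> open_cell e" for z
        using that G subsetD[OF interior_subset] by (force simp: cell)
    qed (use x inv' open_open_cell[OF e] in \<open>auto simp: cell\<close>)
    then have "(q \<circ> G has_derivative ?u') (at (F x))"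
      by (rule diff_chain_at) (simp add: G xR q')
    then have der: "(u has_derivative ?u') (at (F x))"
    proof (rule has_derivative_transform_within_open)
      show "(q \<circ> G) z = u z" if z: "z \<in> open_cell e" for z
      proof -
        obtain w where w: "w \<in> interior R" "z = F w" using z by (auto simp: cell)
        then have "w \<in> R" using interior_subset by blast
        then show ?thesis using u[of w] G[of w] w by (simp add: F_def R_def)
      qed
    qed (use x open_open_cell[OF e] in \<open>auto simp: cell\<close>)
    have fd: "frechet_derivative u (at (F x)) = ?u'"
      using frechet_derivative_at[OF der] by simp
    have "A x *v grad u (F x) = (\<chi> i. q' x (axis i 1))"
    proof (simp add: vec_eq_iff, intro allI)
      fix i
      have "(A x *v grad u (F x)) $ i = (\<Sum>k\<in>UNIV. F' x (axis i 1) $ k * ?u' (axis k 1))"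
        by (simp add: matrix_vector_mult_def A grad_def fd)
      also have "\<dots> = ?u' (F' x (axis i 1))"
        by (rule linear_eq_sum_axis[symmetric]) (rule has_derivative_linear[OF der])
      also have "\<dots> = q' x (axis i 1)"
        using fun_cong[OF inv', of "axis i 1"] by simp
      finally show "(A x *v grad u (F x)) $ i = q' x (axis i 1)" .
    qed
    then have "grad u (F x) = H x"
      using det[OF xR] by (subst (asm) cramer) (simp_all add: A_def H_def cong: if_cong)
    then show ?thesis using der by (auto simp: differentiable_def)
  qed
  show ?thesis
  proof (rule that[of "H \<circ> G"])
    show "continuous_on (region e) (H \<circ> G)"
      using contG contH by (intro continuous_on_compose) (auto simp: region G image_image cong: image_cong)
    show "grad u y = (H \<circ> G) y" "u differentiable (at y)" if "y \<in> open_cell e" for y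
      using that * G subsetD[OF interior_subset] by (force simp: cell)+
  qed
qed

lemma fe_space_gradE:
  fixes e :: "'d::finite element"
  assumes "u \<in> fe_space p \<Omega> E" "e \<in> E" "valid_element e"
  obtains g where "continuous_on (region e) g" "\<And>y. y \<in> open_cell e \<Longrightarrow> grad u y = g y"
    "\<And>y. y \<in> open_cell e \<Longrightarrow> u differentiable (at y)"
proof -
  obtain q where q: "q \<in> poly_space (fst e) p" "\<And>x. x \<in> ref_cell (fst e) \<Longrightarrow> u (snd e x) = q x"
    using assms(1,2) unfolding fe_space_def by blast
  show thesis
    by (rule grad_extends_continuously[OF assms(3) q]) (assumption | rule that)+
qed

text \<open>A vanishing \<open>grad\<close> only forces the derivative to vanish where \<open>u\<close> is differentiable; on open
  cells it is.\<close>

lemma grad_zero_imp_const_on_open_cell: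
  assumes "u \<in> fe_space p \<Omega> E" "e \<in> E" "valid_element e"
    and "\<And>y. y \<in> open_cell e \<Longrightarrow> grad u y = 0"
    and "y \<in> open_cell e" "z \<in> open_cell e"
  shows "u y = u z"
proof (rule has_derivative_zero_unique_connected[OF open_open_cell connected_open_cell])
  fix x assume x: "x \<in> open_cell e"
  let ?D = "frechet_derivative u (at x)"
  have "u differentiable (at x)" by (rule fe_space_gradE[OF assms(1-3)]) (use x in auto)
  then have D: "(u has_derivative ?D) (at x)" by (simp add: frechet_derivative_works)
  have "?D = (\<lambda>h. 0)"
  proof
    fix h show "?D h = 0" using linear_eq_sum_axis[OF has_derivative_linear[OF D], of h] assms(4)[OF x]
      by (simp add: grad_def vec_eq_iff)
  qed
  with D show "(u has_derivative (\<lambda>h. 0)) (at x)" by simp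
qed (fact assms)+

section \<open>Element-wise integration\<close>

lemma set_integrable_compact:
  fixes g :: "'a::euclidean_space \<Rightarrow> real"
  assumes "compact S" "continuous_on S g"
  shows "set_integrable lebesgue S g"
proof -
  have "integrable lborel (\<lambda>x. indicator S x *\<^sub>R g x)" by (rule borel_integrable_compact[OF assms])
  then show ?thesis
    by (auto simp: set_integrable_def integrable_completion borel_measurable_integrable)
qed

text \<open>The bound on \<open>h\<close> near the boundary of the element comes from a continuous extension to the
  compact region.\<close>

lemma set_integrable_open_cell:
  assumes "valid_element e" "continuous_on (region e) g" "\<And>x. x \<in> open_cell e \<Longrightarrow> h x = g x"
  shows "set_integrable lebesgue (open_cell e) (h :: _ \<Rightarrow> real)"
proof -
  have "set_integrable lebesgue (open_cell e) g"
    by (rule set_integrable_subset[OF set_integrable_compact[OF compact_region[OF assms(1)] assms(2)]])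
      (auto simp: open_open_cell[OF assms(1)] open_cell_subset_region)
  then show ?thesis using assms(3) by (simp cong: set_integrable_cong)
qed

text \<open>The interior of a patch exceeds the union of its open cells only by parts of element
  boundaries, which form a null set.\<close>

lemma subdom_integral_eq_sum:
  fixes E :: "'d::finite element set" and h :: "real ^ 'd \<Rightarrow> real"
  assumes "finite E" "\<And>e. e \<in> E \<Longrightarrow> valid_element e" "conforming E"
    and h: "\<And>e. e \<in> E \<Longrightarrow> set_integrable lebesgue (open_cell e) h"
  shows "set_integrable lebesgue (subdom E) h" (is ?int)
    and "(LINT x:subdom E|lebesgue. h x) = (\<Sum>e\<in>E. LINT x:open_cell e|lebesgue. h x)" (is ?eq)
proof -
  let ?U = "\<Union>e\<in>E. open_cell e"
  have "?U \<subseteq> subdom E"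
    unfolding subdom_def patch_def
  proof (rule interior_maximal)
    show "?U \<subseteq> (\<Union>e\<in>E. region e)" using open_cell_subset_region by (rule UN_mono[OF order_refl])
    show "open ?U" using assms(2) by (intro open_UN ballI open_open_cell)
  qed
  \<comment> \<open>Points of the subdomain outside all open cells lie on element boundaries.\<close>
  moreover have "subdom E - ?U \<subseteq> (\<Union>e\<in>E. region e - open_cell e)"
    using interior_subset[of "patch E"] by (auto simp: subdom_def patch_def)
  moreover have neg: "negligible (\<Union>e\<in>E. region e - open_cell e)"
    using assms(1,2) by (intro negligible_Union) (auto simp: negligible_region_minus_open_cell)
  ultimately have spike: "negligible {x \<in> ?U - subdom E. h x \<noteq> 0}" "negligible {x \<in> subdom E - ?U. h x \<noteq> 0}"
    by (auto intro!: negligible_subset[OF neg])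
  have meas: "open_cell e \<in> sets lebesgue" if "e \<in> E" for e
    using open_open_cell[OF assms(2)[OF that]] by simp
  have U: "set_integrable lebesgue ?U h"
    using assms(1) by (intro set_integrable_UN h meas)
  then show ?int
    by (simp only: absolutely_integrable_spike_set_eq[OF spike])
  have "disjoint_family_on open_cell E"
    using open_cell_disjoint_region[OF assms(3)] open_cell_subset_region assms(2)
    unfolding disjoint_family_on_def by blast
  then have "(\<Sum>e\<in>E. LINT x:open_cell e|lebesgue. h x) = (LINT x:?U|lebesgue. h x)"
    using assms(1) by (intro set_integral_finite_Union[symmetric] h meas)
  also have "\<dots> = (LINT x:subdom E|lebesgue. h x)"
    using U \<open>?int\<close> spike
    by (simp only: set_lebesgue_integral_eq_integral(2) integral_spike_set[OF spike])
  finally show ?eq by simp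
qed

text \<open>The set where \<open>h\<close> is nonzero is open and null, hence empty.\<close>

lemma set_integral_eq_0_imp_zero_on_open:
  fixes h :: "'a::euclidean_space \<Rightarrow> real"
  assumes "open S" "continuous_on S h" "set_integrable lebesgue S h"
    and "\<And>x. x \<in> S \<Longrightarrow> 0 \<le> h x" "(LINT x:S|lebesgue. h x) = 0" "x \<in> S"
  shows "h x = 0"
proof -
  have "AE x in lebesgue. indicator S x *\<^sub>R h x = 0"
    using assms by (subst integral_nonneg_eq_0_iff_AE[symmetric])
      (auto simp: set_integrable_def set_lebesgue_integral_def indicator_def)
  then have ae: "AE x in lebesgue. x \<notin> S \<inter> h -` (- {0})"
    by eventually_elim auto
  have op: "open (S \<inter> h -` (- {0}))"
    using assms(1,2) by (intro continuous_open_preimage) auto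
  then have "S \<inter> h -` (- {0}) \<in> null_sets lebesgue"
    using ae by (subst AE_iff_null_sets) auto
  then have "S \<inter> h -` (- {0}) = {}"
    using open_not_negligible[OF op] negligible_iff_null_sets by blast
  then show ?thesis using assms by auto
qed

text \<open>The properties of a mesh that pass to any subset of its elements, in particular to subdomains.\<close>

definition admissible :: "'d::finite element set \<Rightarrow> bool" where
  "admissible E \<longleftrightarrow> finite E \<and> (\<forall>e\<in>E. valid_element e) \<and> conforming E"

lemma admissible_mesh: "fe_mesh \<Omega> \<theta> \<Longrightarrow> admissible \<theta>"
  by (simp add: fe_mesh_def admissible_def)

lemma admissible_subset: "admissible E \<Longrightarrow> E' \<subseteq> E \<Longrightarrow> admissible E'"
  unfolding admissible_def conforming_def by (meson finite_subset subset_iff)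

lemma compact_patch: "admissible E \<Longrightarrow> compact (patch E)"
  unfolding patch_def admissible_def by (intro compact_UN) (auto intro: compact_region)

lemma open_subdom: "open (subdom E)"
  by (simp add: subdom_def)

lemma open_cell_subset_subdom:
  assumes "admissible E" "e \<in> E" shows "open_cell e \<subseteq> subdom E"
  unfolding subdom_def
proof (rule interior_maximal)
  show "open_cell e \<subseteq> patch E"
    using open_cell_subset_region[of e] assms(2) by (auto simp: patch_def)
  show "open (open_cell e)" using assms by (simp add: open_open_cell admissible_def)
qed

text \<open>A patch has no lower-dimensional parts, because each region is the closure of its open cell. Hence
  integrals over the open subdomain control a continuous function on the whole patch.\<close>

lemma closure_subdom:
  assumes "admissible E" shows "closure (subdom E) = patch E"
proof
  show "closure (subdom E) \<subseteq> patch E"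
    unfolding subdom_def
    by (rule closure_minimal[OF interior_subset compact_imp_closed[OF compact_patch[OF assms]]])
  have "region e \<subseteq> closure (subdom E)" if "e \<in> E" for e
    using region_subset_closure_open_cell[of e] closure_mono[OF open_cell_subset_subdom[OF assms that]]
      assms that by (auto simp: admissible_def)
  then show "patch E \<subseteq> closure (subdom E)" by (auto simp: patch_def)
qed

section \<open>Mass and stiffness forms on a subdomain\<close>

lemma fe_space_continuous: "u \<in> fe_space p \<Omega> E \<Longrightarrow> continuous_on (patch E) u"
  by (simp add: fe_space_def)

lemma fe_space_eqI:
  assumes "u \<in> fe_space p \<Omega> E" "v \<in> fe_space p \<Omega> E" "\<And>x. x \<in> patch E \<Longrightarrow> u x = v x"
  shows "u = v"
proof
  fix x show "u x = v x" using assms by (cases "x \<in> patch E") (auto simp: fe_space_def)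
qed

lemma zero_in_fe_space: "(\<lambda>x. 0) \<in> fe_space p \<Omega> E"
proof -
  have "(\<lambda>x. 0) \<in> poly_space c p" for c
    unfolding poly_space_def by (auto intro!: exI[of _ "\<lambda>_. 0"])
  then show ?thesis unfolding fe_space_def by (auto intro!: bexI[of _ "\<lambda>x. 0"])
qed

lemma mass_form_elementwise:
  assumes "admissible E" "continuous_on (patch E) u" "continuous_on (patch E) v"
  shows "set_integrable lebesgue (subdom E) (\<lambda>x. u x * v x)"
    and "mass_form (subdom E) u v = (\<Sum>e\<in>E. LINT x:open_cell e|lebesgue. u x * v x)"
proof -
  have "set_integrable lebesgue (open_cell e) (\<lambda>x. u x * v x)" if "e \<in> E" for e
  proof (rule set_integrable_open_cell)
    show "continuous_on (region e) (\<lambda>x. u x * v x)"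
      using assms that
      by (intro continuous_on_mult) (auto simp: patch_def intro: continuous_on_subset)
  qed (use assms that in \<open>auto simp: admissible_def\<close>)
  then show "set_integrable lebesgue (subdom E) (\<lambda>x. u x * v x)"
    "mass_form (subdom E) u v = (\<Sum>e\<in>E. LINT x:open_cell e|lebesgue. u x * v x)"
    using assms(1) unfolding mass_form_def admissible_def
    by (auto intro!: subdom_integral_eq_sum)
qed

lemma set_integrable_stiffness_cell:
  assumes "admissible E" "u \<in> fe_space p \<Omega> E" "v \<in> fe_space p \<Omega> E" "e \<in> E"
  shows "set_integrable lebesgue (open_cell e) (\<lambda>x. \<nu> * (grad u x \<bullet> grad v x))"
proof -
  have e: "valid_element e" using assms by (simp add: admissible_def)
  obtain g where g: "continuous_on (region e) g" "\<And>y. y \<in> open_cell e \<Longrightarrow> grad u y = g y"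
    by (rule fe_space_gradE[OF assms(2,4) e]) blast
  obtain h where h: "continuous_on (region e) h" "\<And>y. y \<in> open_cell e \<Longrightarrow> grad v y = h y"
    by (rule fe_space_gradE[OF assms(3,4) e]) blast
  show ?thesis
    by (rule set_integrable_open_cell[OF e, where g = "\<lambda>x. \<nu> * (g x \<bullet> h x)"])
      (use g h in \<open>auto intro!: continuous_intros\<close>)
qed

lemma stiffness_form_eq_sum:
  assumes "admissible E" "u \<in> fe_space p \<Omega> E" "v \<in> fe_space p \<Omega> E"
  shows "stiffness_form \<nu> (subdom E) u v =
    (\<Sum>e\<in>E. LINT x:open_cell e|lebesgue. \<nu> * (grad u x \<bullet> grad v x))"
  unfolding stiffness_form_def
  using assms set_integrable_stiffness_cell[OF assms]
  by (intro subdom_integral_eq_sum) (auto simp: admissible_def)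

lemma sum_partition_on:
  assumes "partition_on \<theta> \<Theta>" "finite \<theta>"
  shows "(\<Sum>\<omega>\<in>\<Theta>. \<Sum>e\<in>\<omega>. h e) = sum h \<theta>"
proof -
  have \<theta>: "\<theta> = \<Union>\<Theta>" using assms(1) by (rule partition_onD1)
  then have "finite \<omega>" if "\<omega> \<in> \<Theta>" for \<omega> using assms(2) that by (meson Union_upper finite_subset)
  then show ?thesis
    unfolding \<theta> using partition_onD2[OF assms(1)]
    by (subst sum.Union_disjoint) (auto simp: disjoint_def)
qed

text \<open>Both sides are the same sum of integrals over open cells, grouped by subdomain on the left.\<close>

lemma mass_form_subdomains:
  assumes "admissible \<theta>" "partition_on \<theta> \<Theta>"
    and "continuous_on (patch \<theta>) u" "continuous_on (patch \<theta>) v"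
  shows "(\<Sum>\<omega>\<in>\<Theta>. mass_form (subdom \<omega>) (restrict_to \<omega> u) (restrict_to \<omega> v)) = mass_form (subdom \<theta>) u v"
proof -
  have "mass_form (subdom \<omega>) (restrict_to \<omega> u) (restrict_to \<omega> v) =
      (\<Sum>e\<in>\<omega>. LINT x:open_cell e|lebesgue. u x * v x)" if "\<omega> \<in> \<Theta>" for \<omega>
  proof -
    have sub: "\<omega> \<subseteq> \<theta>" using assms(2) that by (auto simp: partition_on_def)
    then have adm: "admissible \<omega>" using assms(1) by (rule admissible_subset[rotated])
    have psub: "patch \<omega> \<subseteq> patch \<theta>" using sub by (auto simp: patch_def)
    have "mass_form (subdom \<omega>) (restrict_to \<omega> u) (restrict_to \<omega> v) = mass_form (subdom \<omega>) u v"
      unfolding mass_form_def using interior_subset[of "patch \<omega>"]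
      by (intro set_lebesgue_integral_cong) (auto simp: subdom_def restrict_to_def)
    also have "\<dots> = (\<Sum>e\<in>\<omega>. LINT x:open_cell e|lebesgue. u x * v x)"
      by (intro mass_form_elementwise adm continuous_on_subset[OF _ psub] assms)
    finally show ?thesis .
  qed
  then have "(\<Sum>\<omega>\<in>\<Theta>. mass_form (subdom \<omega>) (restrict_to \<omega> u) (restrict_to \<omega> v)) =
      (\<Sum>\<omega>\<in>\<Theta>. \<Sum>e\<in>\<omega>. LINT x:open_cell e|lebesgue. u x * v x)" by simp
  also have "\<dots> = mass_form (subdom \<theta>) u v"
    using assms by (subst sum_partition_on) (auto simp: admissible_def mass_form_elementwise(2))
  finally show ?thesis .
qed

lemma stiffness_form_subdomains:
  assumes "admissible \<theta>" "partition_on \<theta> \<Theta>"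
    and "u \<in> fe_space p \<Omega> \<theta>" "v \<in> fe_space p \<Omega> \<theta>"
  shows "(\<Sum>\<omega>\<in>\<Theta>. stiffness_form \<nu> (subdom \<omega>) (restrict_to \<omega> u) (restrict_to \<omega> v))
    = stiffness_form \<nu> (subdom \<theta>) u v"
proof -
  let ?h = "\<lambda>x. \<nu> * (grad u x \<bullet> grad v x)"
  have "stiffness_form \<nu> (subdom \<omega>) (restrict_to \<omega> u) (restrict_to \<omega> v) =
      (\<Sum>e\<in>\<omega>. LINT x:open_cell e|lebesgue. ?h x)" if "\<omega> \<in> \<Theta>" for \<omega>
  proof -
    have sub: "\<omega> \<subseteq> \<theta>" using assms(2) that by (auto simp: partition_on_def)
    then have adm: "admissible \<omega>" using assms(1) by (rule admissible_subset[rotated])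
    have "grad (restrict_to \<omega> w) x = grad w x" if "x \<in> subdom \<omega>" for w x
      using interior_subset[of "patch \<omega>"] that
      by (intro grad_cong_open[OF open_subdom[of \<omega>]]) (auto simp: subdom_def restrict_to_def)
    then have "stiffness_form \<nu> (subdom \<omega>) (restrict_to \<omega> u) (restrict_to \<omega> v) =
        (LINT x:subdom \<omega>|lebesgue. ?h x)"
      unfolding stiffness_form_def
      by (intro set_lebesgue_integral_cong) (auto simp: open_subdom)
    also have "\<dots> = (\<Sum>e\<in>\<omega>. LINT x:open_cell e|lebesgue. ?h x)"
      using adm sub set_integrable_stiffness_cell[OF assms(1,3,4)]
      by (intro subdom_integral_eq_sum) (auto simp: admissible_def)
    finally show ?thesis .
  qed
  then have "(\<Sum>\<omega>\<in>\<Theta>. stiffness_form \<nu> (subdom \<omega>) (restrict_to \<omega> u) (restrict_to \<omega> v)) =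
      (\<Sum>\<omega>\<in>\<Theta>. \<Sum>e\<in>\<omega>. LINT x:open_cell e|lebesgue. ?h x)" by simp
  also have "\<dots> = stiffness_form \<nu> (subdom \<theta>) u v"
    using assms by (subst sum_partition_on) (auto simp: admissible_def stiffness_form_eq_sum)
  finally show ?thesis .
qed

lemma mass_form_nonneg: "0 \<le> mass_form D w w"
  unfolding mass_form_def set_lebesgue_integral_def by (intro Bochner_Integration.integral_nonneg) auto

lemma stiffness_form_nonneg: "0 \<le> \<nu> \<Longrightarrow> 0 \<le> stiffness_form \<nu> D w w"
  unfolding stiffness_form_def set_lebesgue_integral_def by (intro Bochner_Integration.integral_nonneg) auto

lemma mass_form_zero [simp]: "mass_form D (\<lambda>x. 0) w = 0" "mass_form D w (\<lambda>x. 0) = 0"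
  by (simp_all add: mass_form_def)

text \<open>The polarisation identity \<open>(u - w) u = ((u - w)\<^sup>2 + u\<^sup>2 - w\<^sup>2) / 2\<close>, the source of numerical
  dissipation in the Backward-Euler scheme.\<close>

lemma mass_form_diff:
  assumes "admissible E" "continuous_on (patch E) u" "continuous_on (patch E) w"
  defines "d \<equiv> \<lambda>x. u x - w x"
  shows "mass_form (subdom E) d u =
    (mass_form (subdom E) d d + mass_form (subdom E) u u - mass_form (subdom E) w w) / 2"
proof -
  let ?I = "set_integrable lebesgue (subdom E)"
  have d: "continuous_on (patch E) d" unfolding d_def by (intro continuous_intros assms)
  have i: "?I (\<lambda>x. d x * d x)" "?I (\<lambda>x. u x * u x)" "?I (\<lambda>x. w x * w x)"
    by (intro mass_form_elementwise(1) assms d)+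
  have "mass_form (subdom E) d u =
      (LINT x:subdom E|lebesgue. (d x * d x + u x * u x - w x * w x) / 2)"
    unfolding mass_form_def d_def
    by (intro set_lebesgue_integral_cong) (auto simp: open_subdom algebra_simps)
  also have "\<dots> = (LINT x:subdom E|lebesgue. d x * d x + u x * u x - w x * w x) / 2"
    by (rule set_integral_divide_zero)
  also have "(LINT x:subdom E|lebesgue. d x * d x + u x * u x - w x * w x) =
      mass_form (subdom E) d d + mass_form (subdom E) u u - mass_form (subdom E) w w"
    unfolding mass_form_def
    using i by (simp only: set_integral_diff(2)[OF set_integral_add(1)] set_integral_add(2))
  finally show ?thesis .
qed

lemma mass_form_eq_0_imp_zero:
  assumes "admissible E" "continuous_on (patch E) w" "mass_form (subdom E) w w = 0" "x \<in> patch E"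
  shows "w x = 0"
proof -
  have sub: "subdom E \<subseteq> patch E" by (simp add: subdom_def interior_subset)
  have zero: "w y = 0" if "y \<in> subdom E" for y
  proof -
    have "w y * w y = 0"
    proof (rule set_integral_eq_0_imp_zero_on_open[OF open_subdom _ _ _ _ that])
      show "continuous_on (subdom E) (\<lambda>x. w x * w x)"
        by (intro continuous_on_mult continuous_on_subset[OF assms(2) sub])
    qed (use assms mass_form_elementwise in \<open>auto simp: mass_form_def\<close>)
    then show ?thesis by simp
  qed
  show ?thesis
    using continuous_constant_on_closure[of "subdom E" w 0 x] assms zero
    by (simp add: closure_subdom)
qed

text \<open>The gradient vanishes on each open cell, so \<open>u\<close> is constant on each region. On the patch it thus
  takes finitely many values, and a continuous function with finite range is constant on connected
  sets.\<close>

lemma stiffness_form_eq_0_imp_const: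
  assumes "admissible E" "u \<in> fe_space p \<Omega> E" "0 < \<nu>" "stiffness_form \<nu> (subdom E) u u = 0"
    and C: "C \<in> components (patch E)"
  shows "u constant_on C"
proof -
  let ?h = "\<lambda>x. \<nu> * (grad u x \<bullet> grad u x)"
  have fin: "finite E" using assms by (simp add: admissible_def)
  have int0: "(LINT x:open_cell e|lebesgue. ?h x) = 0" if "e \<in> E" for e
  proof -
    have nonneg: "0 \<le> (LINT x:open_cell e|lebesgue. ?h x)" for e
      using assms(3) unfolding set_lebesgue_integral_def by (intro Bochner_Integration.integral_nonneg) auto
    have total: "(\<Sum>e\<in>E. LINT x:open_cell e|lebesgue. ?h x) = 0"
      using assms(4) by (simp only: stiffness_form_eq_sum[OF assms(1,2,2)])
    show ?thesis by (rule sum_nonneg_0[OF fin _ total that]) (rule nonneg)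
  qed
  have const: "\<exists>c. \<forall>y\<in>region e. u y = c" if e: "e \<in> E" for e
  proof -
    have ve: "valid_element e" using assms e by (simp add: admissible_def)
    obtain g where g: "continuous_on (region e) g" "\<And>y. y \<in> open_cell e \<Longrightarrow> grad u y = g y"
      by (rule fe_space_gradE[OF assms(2) e ve]) blast
    have "continuous_on (open_cell e) (\<lambda>x. \<nu> * (g x \<bullet> g x))"
      using continuous_on_subset[OF g(1) open_cell_subset_region] by (intro continuous_intros)
    then have cont: "continuous_on (open_cell e) ?h"
      by (rule continuous_on_eq) (simp add: g)
    have "?h y = 0" if "y \<in> open_cell e" for y
      using assms(3) by (intro set_integral_eq_0_imp_zero_on_open[OF open_open_cell[OF ve] cont _ _ int0[OF e] that]
        set_integrable_stiffness_cell[OF assms(1,2,2) e]) simp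
    then have "grad u y = 0" if "y \<in> open_cell e" for y using assms(3) that by simp
    then have eq: "u y = u z" if "y \<in> open_cell e" "z \<in> open_cell e" for y z
      using grad_zero_imp_const_on_open_cell[OF assms(2) e ve] that by blast
    obtain c where c: "\<And>y. y \<in> open_cell e \<Longrightarrow> u y = c"
      using eq by blast
    have clos: "closure (open_cell e) = region e"
      using region_subset_closure_open_cell[OF ve]
        closure_minimal[OF open_cell_subset_region compact_imp_closed[OF compact_region[OF ve]]] by blast
    have "continuous_on (closure (open_cell e)) u"
      unfolding clos using fe_space_continuous[OF assms(2)] e
      by (auto simp: patch_def intro: continuous_on_subset)
    then have "u y = c" if "y \<in> region e" for y
      using continuous_constant_on_closure[of "open_cell e" u c y] c that by (simp add: clos)
    then show ?thesis by blast
  qed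
  show ?thesis
  proof (rule continuous_finite_range_constant)
    show "connected C" using C by (rule in_components_connected)
    show "continuous_on C u"
      using fe_space_continuous[OF assms(2)] in_components_subset[OF C] by (rule continuous_on_subset)
    obtain c where c: "\<And>e y. e \<in> E \<Longrightarrow> y \<in> region e \<Longrightarrow> u y = c e" using const by metis
    have "u ` C \<subseteq> c ` E"
    proof
      fix z assume "z \<in> u ` C"
      then obtain y where "y \<in> patch E" "z = u y" using in_components_subset[OF C] by blast
      then show "z \<in> c ` E" using c by (auto simp: patch_def)
    qed
    then show "finite (u ` C)" using fin finite_subset by blast
  qed
qed

text \<open>A ball inside the subdomain is connected, so it lies in a single component of the patch.\<close>

lemma const_on_components_imp_stiffness_0:
  assumes "\<And>C. C \<in> components (patch E) \<Longrightarrow> u constant_on C"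
  shows "stiffness_form \<nu> (subdom E) u v = 0"
proof -
  have "grad u x = 0" if x: "x \<in> subdom E" for x
  proof -
    obtain r where r: "0 < r" "ball x r \<subseteq> subdom E"
      using x open_subdom openE by blast
    then have sub: "ball x r \<subseteq> patch E" using interior_subset[of "patch E"] by (auto simp: subdom_def)
    then obtain C where C: "C \<in> components (patch E)" "ball x r \<subseteq> C"
      using exists_component_superset[OF sub] r connected_ball by (metis centre_in_ball empty_iff subset_empty)
    then obtain c where "\<And>y. y \<in> C \<Longrightarrow> u y = c" using assms[OF C(1)] by (auto simp: constant_on_def)
    then show ?thesis using C(2) r by (intro grad_const_on_open[of "ball x r" x u c]) auto
  qed
  then have "stiffness_form \<nu> (subdom E) u v = (LINT x:subdom E|lebesgue. 0)"
    unfolding stiffness_form_def by (intro set_lebesgue_integral_cong) (auto simp: open_subdom)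
  then show ?thesis by simp
qed

text \<open>A point of the patch on the frontier of \<open>\<Omega>\<close> cannot lie in the subdomain, so it is on its frontier
  as well and carries the Dirichlet condition.\<close>

lemma non_floating_const_imp_zero:
  assumes "admissible E" "u \<in> fe_space p \<Omega> E" "subdom E \<subseteq> \<Omega>" "open \<Omega>" "non_floating \<Omega> E"
    and const: "\<And>C. C \<in> components (patch E) \<Longrightarrow> u constant_on C"
  shows "u = (\<lambda>x. 0)"
proof (rule fe_space_eqI[OF assms(2) zero_in_fe_space])
  fix x assume "x \<in> patch E"
  then obtain C where C: "C \<in> components (patch E)" "x \<in> C"
    by (metis Union_components UnionE)
  then obtain y where y: "y \<in> C" "y \<in> frontier \<Omega>"
    using assms(5) by (auto simp: non_floating_def)
  then have "y \<in> patch E" using C in_components_subset by blast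
  moreover have "y \<notin> \<Omega>" using y(2) assms(4) by (auto simp: frontier_def interior_open)
  ultimately have "y \<in> frontier (subdom E)"
    using assms(3) closure_subdom[OF assms(1)] by (auto simp: frontier_def interior_open[OF open_subdom])
  then have "u y = 0" using assms(2) y by (auto simp: fe_space_def)
  then show "u x = 0" using const[OF C(1)] C(2) y(1) by (auto simp: constant_on_def)
qed

section \<open>Sums over the time partition\<close>

lemma sum_time_subdomains:
  fixes g :: "nat \<Rightarrow> real"
  assumes "m 0 = 0" "strict_mono_on {0..N} m"
  shows "(\<Sum>n=1..N. \<Sum>k=1..steps m n. g (m (n - 1) + k)) = (\<Sum>k=1..m N. g k)"
  using assms(2)
proof (induction N)
  case 0
  then show ?case using assms(1) by simp
next
  case (Suc N)
  have "m N < m (Suc N)" using Suc.prems by (auto simp: strict_mono_on_def)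
  then have split: "m (Suc N) = m N + steps m (Suc N)" by (simp add: steps_def)
  have "strict_mono_on {0..N} m" using Suc.prems by (auto simp: strict_mono_on_def)
  then have "(\<Sum>n=1..Suc N. \<Sum>k=1..steps m n. g (m (n - 1) + k)) =
      (\<Sum>k=1..m N. g k) + (\<Sum>k=1..steps m (Suc N). g (k + m N))"
    using Suc.IH by (simp add: add.commute)
  also have "(\<Sum>k=1..steps m (Suc N). g (k + m N)) = (\<Sum>k=m N+1..m N + steps m (Suc N). g k)"
    using sum.shift_bounds_cl_nat_ivl[of g 1 "m N" "steps m (Suc N)"] by (simp add: add.commute)
  also have "(\<Sum>k=1..m N. g k) + \<dots> = (\<Sum>k=1..m (Suc N). g k)"
    unfolding split by (rule sum.ub_add_nat[symmetric]) simp
  finally show ?case .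
qed

text \<open>At an interior interface \<open>T\<^sub>n\<close> the subdomain \<open>n\<close> contributes \<open>- c n / 2\<close> and its successor
  \<open>c n / 2\<close>; the Kronecker deltas remove the two unpaired terms.\<close>

lemma interface_terms_cancel:
  fixes c :: "nat \<Rightarrow> real"
  assumes "1 \<le> N"
  shows "(\<Sum>n=1..N. (1 - Kr 1 n) / 2 * c (n - 1) - (1 - Kr N n) / 2 * c n) = 0"
proof -
  obtain M where N: "N = Suc M" using assms by (cases N) auto
  have "(\<Sum>n=1..Suc M. (1 - Kr 1 n) / 2 * c (n - 1)) = (\<Sum>n=1..M. c n / 2)"
    by (induction M) (auto simp: Kr_def)
  moreover have "(\<Sum>n=1..Suc M. (1 - Kr (Suc M) n) / 2 * c n) = (\<Sum>n=1..M. c n / 2)"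
    by (simp add: Kr_def)
  ultimately show ?thesis unfolding N by (simp only: sum_subtractf)
qed

lemma local_time_index:
  assumes "time_partition T K t N m" "n \<in> {1..N}"
  shows "m n = m (n - 1) + steps m n" "1 \<le> steps m n" "m n \<le> K"
proof -
  have mono: "strict_mono_on {0..N} m" and mN: "m N = K" using assms(1) by (auto simp: time_partition_def)
  have "m (n - 1) < m n" using mono assms(2) by (auto simp: strict_mono_on_def)
  then show "m n = m (n - 1) + steps m n" "1 \<le> steps m n" by (auto simp: steps_def)
  show "m n \<le> K" using mono assms(2) mN by (cases "n = N") (auto simp: strict_mono_on_def less_imp_le)
qed

lemma local_time_pos:
  assumes "time_partition T K t N m" "n \<in> {1..N}" "k \<in> {1..steps m n}"
  shows "0 < local_time t m n k - local_time t m n (k - 1)"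
  using assms(1,3) local_time_index[OF assms(1,2)]
  by (auto simp: local_time_def time_partition_def intro!: strict_mono_onD[of "{0..K}" t])

section \<open>Consistency\<close>

lemma st_space_bar_fe_space:
  assumes "u \<in> st_space_bar p \<Omega> \<theta> K" shows "u k \<in> fe_space p \<Omega> \<theta>"
proof -
  consider "k = 0" | "k \<in> {1..K}" | "k > K" by fastforce
  then show ?thesis using assms zero_in_fe_space unfolding st_space_bar_def by cases auto
qed

text \<open>Summed over the spatial subdomains, the local forms on one time subdomain involve only forms on the
  whole domain. The perturbation terms are kept apart because they cancel only between
  different \<open>n\<close>.\<close>

lemma local_form_sum_subdomains:
  assumes T: "time_partition T K t N m" and n: "n \<in> {1..N}"
    and adm: "admissible \<theta>" and P: "partition_on \<theta> \<Theta>"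
    and u: "\<And>k. u k \<in> fe_space p \<Omega> \<theta>" and v: "\<And>k. v k \<in> fe_space p \<Omega> \<theta>"
  shows "(\<Sum>\<omega>\<in>\<Theta>. local_form \<nu> t N m n \<omega> (st_embed \<Theta> N m u n \<omega>) (st_embed \<Theta> N m v n \<omega>)) =
    (\<Sum>k=1..steps m n.
        mass_form (subdom \<theta>) (\<lambda>x. u (m (n - 1) + k) x - u (m (n - 1) + k - 1) x) (v (m (n - 1) + k))
        + (t (m (n - 1) + k) - t (m (n - 1) + k - 1))
            * stiffness_form \<nu> (subdom \<theta>) (u (m (n - 1) + k)) (v (m (n - 1) + k)))
    + ((1 - Kr 1 n) / 2 * mass_form (subdom \<theta>) (u (m (n - 1))) (v (m (n - 1)))
       - (1 - Kr N n) / 2 * mass_form (subdom \<theta>) (u (m n)) (v (m n)))"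
proof -
  let ?M = "\<lambda>\<omega> f g. mass_form (subdom \<omega>) (restrict_to \<omega> f) (restrict_to \<omega> g)"
  let ?K = "\<lambda>\<omega> f g. stiffness_form \<nu> (subdom \<omega>) (restrict_to \<omega> f) (restrict_to \<omega> g)"
  let ?j = "\<lambda>k. m (n - 1) + k"
  let ?d = "\<lambda>k x. u (?j k) x - u (?j k - 1) x"
  have cont: "continuous_on (patch \<theta>) (u k)" "continuous_on (patch \<theta>) (v k)" for k
    using u v by (auto intro: fe_space_continuous)
  have "local_form \<nu> t N m n \<omega> (st_embed \<Theta> N m u n \<omega>) (st_embed \<Theta> N m v n \<omega>) =
    (\<Sum>k=1..steps m n. ?M \<omega> (?d k) (v (?j k)) + (t (?j k) - t (?j k - 1)) * ?K \<omega> (u (?j k)) (v (?j k)))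
    + ((1 - Kr 1 n) / 2 * ?M \<omega> (u (m (n - 1))) (v (m (n - 1)))
       - (1 - Kr N n) / 2 * ?M \<omega> (u (m n)) (v (m n)))" if \<omega>: "\<omega> \<in> \<Theta>" for \<omega>
  proof -
    have emb: "st_embed \<Theta> N m w n \<omega> k = restrict_to \<omega> (w (?j k))" if "k \<le> steps m n" for w k
      using n \<omega> that by (simp add: st_embed_def)
    have diff: "(\<lambda>x. restrict_to \<omega> f x - restrict_to \<omega> g x) = restrict_to \<omega> (\<lambda>x. f x - g x)" for f g
      by (auto simp: restrict_to_def)
    have pred: "?j (k - 1) = ?j k - 1" if "1 \<le> k" for k using that by simp
    have "(\<Sum>k=1..steps m n.
        mass_form (subdom \<omega>) (\<lambda>x. st_embed \<Theta> N m u n \<omega> k x - st_embed \<Theta> N m u n \<omega> (k - 1) x) (st_embed \<Theta> N m v n \<omega> k)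
        + (local_time t m n k - local_time t m n (k - 1))
            * stiffness_form \<nu> (subdom \<omega>) (st_embed \<Theta> N m u n \<omega> k) (st_embed \<Theta> N m v n \<omega> k)) =
      (\<Sum>k=1..steps m n. ?M \<omega> (?d k) (v (?j k)) + (t (?j k) - t (?j k - 1)) * ?K \<omega> (u (?j k)) (v (?j k)))"
      by (intro sum.cong refl) (auto simp: emb diff local_time_def pred)
    moreover have "st_embed \<Theta> N m w n \<omega> (steps m n) = restrict_to \<omega> (w (m n))" for w
      using local_time_index(1)[OF T n] by (simp add: emb)
    ultimately show ?thesis by (simp add: local_form_def emb)
  qed
  then have "(\<Sum>\<omega>\<in>\<Theta>. local_form \<nu> t N m n \<omega> (st_embed \<Theta> N m u n \<omega>) (st_embed \<Theta> N m v n \<omega>)) =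
    (\<Sum>\<omega>\<in>\<Theta>. (\<Sum>k=1..steps m n. ?M \<omega> (?d k) (v (?j k)) + (t (?j k) - t (?j k - 1)) * ?K \<omega> (u (?j k)) (v (?j k)))
    + ((1 - Kr 1 n) / 2 * ?M \<omega> (u (m (n - 1))) (v (m (n - 1)))
       - (1 - Kr N n) / 2 * ?M \<omega> (u (m n)) (v (m n))))" by simp
  also have "\<dots> = (\<Sum>k=1..steps m n. (\<Sum>\<omega>\<in>\<Theta>. ?M \<omega> (?d k) (v (?j k)))
      + (t (?j k) - t (?j k - 1)) * (\<Sum>\<omega>\<in>\<Theta>. ?K \<omega> (u (?j k)) (v (?j k))))
    + ((1 - Kr 1 n) / 2 * (\<Sum>\<omega>\<in>\<Theta>. ?M \<omega> (u (m (n - 1))) (v (m (n - 1))))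
       - (1 - Kr N n) / 2 * (\<Sum>\<omega>\<in>\<Theta>. ?M \<omega> (u (m n)) (v (m n))))"
    by (simp only: sum.distrib sum_subtractf sum_distrib_left sum.swap[of _ \<Theta>])
  finally have split: "(\<Sum>\<omega>\<in>\<Theta>. local_form \<nu> t N m n \<omega> (st_embed \<Theta> N m u n \<omega>) (st_embed \<Theta> N m v n \<omega>)) = \<dots>" .
  have "(\<Sum>\<omega>\<in>\<Theta>. ?M \<omega> (?d k) (v (?j k))) = mass_form (subdom \<theta>) (?d k) (v (?j k))" for k
    by (intro mass_form_subdomains adm P continuous_intros cont)
  moreover have "(\<Sum>\<omega>\<in>\<Theta>. ?M \<omega> (u k) (v k)) = mass_form (subdom \<theta>) (u k) (v k)" for k
    by (intro mass_form_subdomains adm P cont)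
  moreover have "(\<Sum>\<omega>\<in>\<Theta>. ?K \<omega> (u k) (v k)) = stiffness_form \<nu> (subdom \<theta>) (u k) (v k)" for k
    by (rule stiffness_form_subdomains[OF adm P u v])
  ultimately show ?thesis unfolding split by simp
qed

lemma st_form_embed:
  assumes T: "time_partition T K t N m" and adm: "admissible \<theta>" and P: "partition_on \<theta> \<Theta>"
    and u: "\<And>k. u k \<in> fe_space p \<Omega> \<theta>" and v: "\<And>k. v k \<in> fe_space p \<Omega> \<theta>"
  shows "st_form \<nu> \<Theta> t N m (st_embed \<Theta> N m u) (st_embed \<Theta> N m v) = st_form_bar \<nu> (subdom \<theta>) K t u v"
proof -
  let ?g = "\<lambda>k. mass_form (subdom \<theta>) (\<lambda>x. u k x - u (k - 1) x) (v k)
      + (t k - t (k - 1)) * stiffness_form \<nu> (subdom \<theta>) (u k) (v k)"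
  let ?c = "\<lambda>n. mass_form (subdom \<theta>) (u (m n)) (v (m n))"
  have N: "1 \<le> N" and m: "m 0 = 0" "m N = K" "strict_mono_on {0..N} m"
    using T by (auto simp: time_partition_def)
  have "st_form \<nu> \<Theta> t N m (st_embed \<Theta> N m u) (st_embed \<Theta> N m v) =
      (\<Sum>n=1..N. (\<Sum>k=1..steps m n. ?g (m (n - 1) + k))
        + ((1 - Kr 1 n) / 2 * ?c (n - 1) - (1 - Kr N n) / 2 * ?c n))"
    unfolding st_form_def
    by (intro sum.cong refl local_form_sum_subdomains[OF T _ adm P u v])
  also have "\<dots> = (\<Sum>n=1..N. \<Sum>k=1..steps m n. ?g (m (n - 1) + k))"
    by (simp only: sum.distrib interface_terms_cancel[OF N, of ?c] add_0_right)
  also have "\<dots> = st_form_bar \<nu> (subdom \<theta>) K t u v"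
    using sum_time_subdomains[OF m(1,3), of ?g] by (simp only: st_form_bar_def m(2))
  finally show ?thesis .
qed

lemma st_load_embed:
  assumes T: "time_partition T K t N m"
    and v: "\<And>k. v k \<in> fe_space p \<Omega> \<theta>"
    and f: "\<And>k w. k \<in> {1..K} \<Longrightarrow> w \<in> fe_space p \<Omega> \<theta> \<Longrightarrow>
      (\<Sum>\<omega>\<in>\<Theta>. f \<omega> (t k) (restrict_to \<omega> w)) = fbar (t k) w"
  shows "st_load \<Theta> t N m f (st_embed \<Theta> N m v) = st_load_bar K t fbar v"
proof -
  let ?g = "\<lambda>k. (t k - t (k - 1)) * fbar (t k) (v k)"
  have m: "m 0 = 0" "m N = K" "strict_mono_on {0..N} m"
    using T by (auto simp: time_partition_def)
  have "(\<Sum>\<omega>\<in>\<Theta>. local_load t m f n \<omega> (st_embed \<Theta> N m v n \<omega>)) =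
      (\<Sum>k=1..steps m n. ?g (m (n - 1) + k))" if n: "n \<in> {1..N}" for n
  proof -
    let ?j = "\<lambda>k. m (n - 1) + k"
    have "(\<Sum>\<omega>\<in>\<Theta>. local_load t m f n \<omega> (st_embed \<Theta> N m v n \<omega>)) =
        (\<Sum>\<omega>\<in>\<Theta>. \<Sum>k=1..steps m n. (t (?j k) - t (?j k - 1)) * f \<omega> (t (?j k)) (restrict_to \<omega> (v (?j k))))"
      unfolding local_load_def using n
      by (intro sum.cong refl) (auto simp: local_time_def st_embed_def)
    also have "\<dots> = (\<Sum>k=1..steps m n. (t (?j k) - t (?j k - 1)) *
        (\<Sum>\<omega>\<in>\<Theta>. f \<omega> (t (?j k)) (restrict_to \<omega> (v (?j k)))))"
      by (simp only: sum_distrib_left sum.swap[of _ \<Theta>])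
    also have "\<dots> = (\<Sum>k=1..steps m n. ?g (?j k))"
    proof (intro sum.cong refl)
      fix k assume "k \<in> {1..steps m n}"
      then have "?j k \<in> {1..K}" using local_time_index[OF T n] by auto
      then show "(t (?j k) - t (?j k - 1)) * (\<Sum>\<omega>\<in>\<Theta>. f \<omega> (t (?j k)) (restrict_to \<omega> (v (?j k)))) = ?g (?j k)"
        using f v by simp
    qed
    finally show ?thesis .
  qed
  then have "st_load \<Theta> t N m f (st_embed \<Theta> N m v) =
      (\<Sum>n=1..N. \<Sum>k=1..steps m n. ?g (m (n - 1) + k))"
    unfolding st_load_def by (intro sum.cong refl)
  also have "\<dots> = st_load_bar K t fbar v"
    using sum_time_subdomains[OF m(1,3), of ?g] by (simp only: st_load_bar_def m(2))
  finally show ?thesis .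
qed

section \<open>Energy\<close>

text \<open>Telescoping leaves half of \<open>M(u\<^sub>s, u\<^sub>s) - M(u\<^sub>0, u\<^sub>0)\<close>, where \<open>s\<close> is the last step. The perturbation terms are
  tuned to absorb exactly this difference, except that nothing is subtracted at the final time and
  nothing is added at the initial time.\<close>

lemma local_form_energy:
  fixes m :: "nat \<Rightarrow> nat"
  assumes adm: "admissible \<omega>" and u: "\<And>k. k \<le> steps m n \<Longrightarrow> u k \<in> fe_space p \<Omega> \<omega>"
  defines "D \<equiv> subdom \<omega>"
  shows "local_form \<nu> t N m n \<omega> u u =
    (\<Sum>k=1..steps m n. mass_form D (\<lambda>x. u k x - u (k - 1) x) (\<lambda>x. u k x - u (k - 1) x) / 2
        + (local_time t m n k - local_time t m n (k - 1)) * stiffness_form \<nu> D (u k) (u k))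
    + Kr N n / 2 * mass_form D (u (steps m n)) (u (steps m n)) - Kr 1 n / 2 * mass_form D (u 0) (u 0)"
proof -
  let ?e = "\<lambda>k. mass_form D (u k) (u k) / 2"
  let ?d = "\<lambda>k x. u k x - u (k - 1) x"
  let ?K = "\<lambda>k. (local_time t m n k - local_time t m n (k - 1)) * stiffness_form \<nu> D (u k) (u k)"
  have tele: "(\<Sum>k=1..s. ?e k - ?e (k - 1)) = ?e s - ?e 0" for s
    by (induction s) auto
  have "(\<Sum>k=1..steps m n. mass_form D (?d k) (u k) + ?K k) =
      (\<Sum>k=1..steps m n. mass_form D (?d k) (?d k) / 2 + ?K k + (?e k - ?e (k - 1)))"
  proof (intro sum.cong refl)
    fix k assume "k \<in> {1..steps m n}"
    then show "mass_form D (?d k) (u k) + ?K k = mass_form D (?d k) (?d k) / 2 + ?K k + (?e k - ?e (k - 1))"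
      unfolding D_def
      by (subst mass_form_diff[OF adm])
        (auto intro!: fe_space_continuous u simp: diff_divide_distrib add_divide_distrib)
  qed
  also have "\<dots> = (\<Sum>k=1..steps m n. mass_form D (?d k) (?d k) / 2 + ?K k) + (?e (steps m n) - ?e 0)"
    unfolding sum.distrib[of _ "\<lambda>k. ?e k - ?e (k - 1)"] tele ..
  finally show ?thesis
    unfolding local_form_def D_def[symmetric] by (simp add: field_simps)
qed

text \<open>With the initial condition the energy is a sum of nonnegative terms. If it vanishes, the dissipation
  terms make \<open>u\<close> constant in time and the stiffness terms make it constant on components; the
  initial value for \<open>n = 1\<close> and the surviving final term for \<open>n = N\<close> make it zero.\<close>

lemma local_form_definite:
  fixes m :: "nat \<Rightarrow> nat"
  assumes adm: "admissible \<omega>" and u: "\<And>k. k \<le> steps m n \<Longrightarrow> u k \<in> fe_space p \<Omega> \<omega>"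
    and s: "1 \<le> steps m n" and \<nu>: "0 < \<nu>"
    and \<tau>: "\<And>k. k \<in> {1..steps m n} \<Longrightarrow> 0 < local_time t m n k - local_time t m n (k - 1)"
    and init: "n = 1 \<Longrightarrow> u 0 = (\<lambda>x. 0)"
  shows "0 \<le> local_form \<nu> t N m n \<omega> u u"
    and "local_form \<nu> t N m n \<omega> u u = 0 \<longleftrightarrow>
      (\<forall>k\<le>steps m n. u k = u 0) \<and> (n = 1 \<or> n = N \<longrightarrow> u 0 = (\<lambda>x. 0)) \<and>
      (\<forall>C\<in>components (patch \<omega>). u 0 constant_on C)"
proof -
  let ?D = "subdom \<omega>"
  let ?s = "steps m n"
  let ?d = "\<lambda>k x. u k x - u (k - 1) x"
  let ?a = "\<lambda>k. mass_form ?D (?d k) (?d k) / 2"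
  let ?b = "\<lambda>k. (local_time t m n k - local_time t m n (k - 1)) * stiffness_form \<nu> ?D (u k) (u k)"
  let ?r = "Kr N n / 2 * mass_form ?D (u ?s) (u ?s)"
  have "Kr 1 n / 2 * mass_form ?D (u 0) (u 0) = 0"
    using init by (auto simp: Kr_def)
  then have form: "local_form \<nu> t N m n \<omega> u u = (\<Sum>k=1..?s. ?a k + ?b k) + ?r"
    using local_form_energy[OF adm u] by simp
  have a: "0 \<le> ?a k" for k by (simp add: mass_form_nonneg)
  have b: "0 \<le> ?b k" if "k \<in> {1..?s}" for k
    using \<tau>[OF that] \<nu> by (intro mult_nonneg_nonneg stiffness_form_nonneg) auto
  have r: "0 \<le> ?r" by (simp add: mass_form_nonneg Kr_def)
  have ab: "0 \<le> (\<Sum>k=1..?s. ?a k + ?b k)" by (intro sum_nonneg add_nonneg_nonneg a b)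
  show "0 \<le> local_form \<nu> t N m n \<omega> u u" using ab r form by simp
  show "local_form \<nu> t N m n \<omega> u u = 0 \<longleftrightarrow>
      (\<forall>k\<le>?s. u k = u 0) \<and> (n = 1 \<or> n = N \<longrightarrow> u 0 = (\<lambda>x. 0)) \<and>
      (\<forall>C\<in>components (patch \<omega>). u 0 constant_on C)" (is "_ \<longleftrightarrow> ?rhs")
  proof
    assume "local_form \<nu> t N m n \<omega> u u = 0"
    then have "(\<Sum>k=1..?s. ?a k + ?b k) = 0" and r0: "?r = 0" using ab r form by linarith+
    then have sum0: "?a k + ?b k = 0" if "k \<in> {1..?s}" for k
      by (intro sum_nonneg_0[OF _ _ _ that, of "\<lambda>k. ?a k + ?b k"] add_nonneg_nonneg a b) simp_all
    have ab0: "?a k = 0" "?b k = 0" if "k \<in> {1..?s}" for k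
      using sum0[OF that] a[of k] b[OF that] by linarith+
    have step: "u k = u (k - 1)" if "k \<in> {1..?s}" for k
    proof (rule fe_space_eqI)
      show k: "u k \<in> fe_space p \<Omega> \<omega>" "u (k - 1) \<in> fe_space p \<Omega> \<omega>" using that by (auto intro: u)
      have "continuous_on (patch \<omega>) (?d k)"
        by (intro continuous_on_diff fe_space_continuous[OF k(1)] fe_space_continuous[OF k(2)])
      moreover have "mass_form ?D (?d k) (?d k) = 0" using ab0(1)[OF that] by simp
      moreover fix x assume "x \<in> patch \<omega>"
      ultimately have "?d k x = 0" by (rule mass_form_eq_0_imp_zero[OF adm])
      then show "u k x = u (k - 1) x" by simp
    qed
    have eq: "u k = u 0" if "k \<le> ?s" for k
      using that
    proof (induction k)
      case (Suc k)
      then show ?case using step[of "Suc k"] by simp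
    qed simp
    have "stiffness_form \<nu> ?D (u 1) (u 1) = 0" using ab0(2)[of 1] \<tau>[of 1] s by simp
    then have const: "u 1 constant_on C" if "C \<in> components (patch \<omega>)" for C
      by (rule stiffness_form_eq_0_imp_const[OF adm u[OF s] \<nu> _ that])
    have final: "u 0 = (\<lambda>x. 0)" if "n = N"
    proof (rule fe_space_eqI[OF u zero_in_fe_space])
      fix x assume "x \<in> patch \<omega>"
      moreover have "mass_form ?D (u 0) (u 0) = 0" using r0 that eq[of ?s] by (simp add: Kr_def)
      ultimately show "u 0 x = 0"
        by (intro mass_form_eq_0_imp_zero[OF adm fe_space_continuous[OF u[of 0]]]) simp_all
    qed simp
    show ?rhs
      using const final init unfolding eq[OF s] by (intro conjI allI impI ballI eq) blast+
  next
    assume rhs: ?rhs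
    have eq: "u k = u 0" if "k \<le> ?s" for k using rhs that by blast
    have stiff: "stiffness_form \<nu> ?D (u 0) (u 0) = 0"
      using rhs by (intro const_on_components_imp_stiffness_0) blast
    have "?a k + ?b k = 0" if "k \<in> {1..?s}" for k
    proof -
      have k: "u k = u 0" by (rule eq) (use that in simp)
      have k': "u (k - 1) = u 0" by (rule eq) (use that in auto)
      show ?thesis unfolding k k' by (simp add: stiff)
    qed
    then have "(\<Sum>k=1..?s. ?a k + ?b k) = 0" by (intro sum.neutral) blast
    moreover have "?r = 0"
    proof (cases "n = N")
      case True
      then have "u 0 = (\<lambda>x. 0)" using rhs by blast
      then have "u ?s = (\<lambda>x. 0)" using eq[OF order_refl] by (rule trans[rotated])
      then show ?thesis by simp
    qed (simp add: Kr_def)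
    ultimately show "local_form \<nu> t N m n \<omega> u u = 0" using form by linarith
  qed
qed

text \<open>For functions constant in time it suffices to look at the first time value, as values beyond the index
  range are zero anyway.\<close>

lemma floating_modes_iff:
  assumes T: "time_partition T K t N m" and u: "u \<in> st_space p \<Omega> \<Theta> N m"
  shows "u \<in> floating_modes p \<Omega> \<Theta> N m \<longleftrightarrow>
    (\<forall>n\<in>{1..N}. \<forall>\<omega>\<in>\<Theta>. (\<forall>k\<le>steps m n. u n \<omega> k = u n \<omega> 0) \<and>
      (n = 1 \<or> n = N \<longrightarrow> u n \<omega> 0 = (\<lambda>x. 0)) \<and>
      (\<forall>C\<in>components (patch \<omega>). u n \<omega> 0 constant_on C))"
proof -
  have beyond: "u n \<omega> k = (\<lambda>x. 0)" if "\<not> k \<le> steps m n" for n \<omega> k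
    using u that unfolding st_space_def by (simp split: if_splits)
  let ?const = "\<lambda>n \<omega>. \<forall>k\<le>steps m n. u n \<omega> k = u n \<omega> 0"
  have zero: "(\<forall>k. u n \<omega> k = (\<lambda>x. 0)) \<longleftrightarrow> u n \<omega> 0 = (\<lambda>x. 0)" if c: "?const n \<omega>" for n \<omega>
  proof
    assume "u n \<omega> 0 = (\<lambda>x. 0)"
    then show "\<forall>k. u n \<omega> k = (\<lambda>x. 0)" using c beyond by metis
  qed simp
  have "(n = 1 \<or> n = N \<longrightarrow> (\<forall>k. u n \<omega> k = (\<lambda>x. 0))) \<and> ?const n \<omega> \<and> B \<longleftrightarrow>
      ?const n \<omega> \<and> (n = 1 \<or> n = N \<longrightarrow> u n \<omega> 0 = (\<lambda>x. 0)) \<and> B" for n \<omega> B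
    using zero[of n \<omega>] by argo
  then show ?thesis using u unfolding floating_modes_def by (simp only: mem_Collect_eq simp_thms)
qed

theorem proposition4p1:
  fixes \<Omega> :: "(real ^ 'd::finite) set"
    and \<theta> :: "'d element set"
    and \<Theta> :: "'d element set set"
    and p K N :: nat
    and \<nu> T :: real
    and t :: "nat \<Rightarrow> real"
    and m :: "nat \<Rightarrow> nat"
    and fbar :: "real \<Rightarrow> (real ^ 'd \<Rightarrow> real) \<Rightarrow> real"
    and f :: "'d element set \<Rightarrow> real \<Rightarrow> (real ^ 'd \<Rightarrow> real) \<Rightarrow> real"
  assumes "CARD('d) \<in> {2, 3}"
    and "polyhedral_domain \<Omega>"
    and "fe_mesh \<Omega> \<theta>"
    and "partition_on \<theta> \<Theta>"
    and "1 \<le> p"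
    and "0 < \<nu>"
    and "time_partition T K t N m"
    and "\<forall>k\<in>{1..K}. linear_functional_on (fe_space p \<Omega> \<theta>) (fbar (t k))"
    and "\<forall>k\<in>{1..K}. \<forall>\<omega>\<in>\<Theta>. linear_functional_on (fe_space p \<Omega> \<omega>) (f \<omega> (t k))"
    and "\<forall>k\<in>{1..K}. \<forall>v\<in>fe_space p \<Omega> \<theta>. (\<Sum>\<omega>\<in>\<Theta>. f \<omega> (t k) (restrict_to \<omega> v)) = fbar (t k) v"
  shows "(\<forall>u\<in>st_space_bar p \<Omega> \<theta> K. \<forall>v\<in>st_space_bar p \<Omega> \<theta> K.
            st_form \<nu> \<Theta> t N m (st_embed \<Theta> N m u) (st_embed \<Theta> N m v) = st_form_bar \<nu> \<Omega> K t u v)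
       \<and> (\<forall>v\<in>st_space_bar p \<Omega> \<theta> K.
            st_load \<Theta> t N m f (st_embed \<Theta> N m v) = st_load_bar K t fbar v)
       \<and> (\<forall>u\<in>st_space p \<Omega> \<Theta> N m. 0 \<le> st_form \<nu> \<Theta> t N m u u)
       \<and> (\<forall>u\<in>st_space p \<Omega> \<Theta> N m.
            st_form \<nu> \<Theta> t N m u u = 0 \<longleftrightarrow> u \<in> floating_modes p \<Omega> \<Theta> N m)
       \<and> (N \<le> 2 \<or> (\<forall>\<omega>\<in>\<Theta>. non_floating \<Omega> \<omega>) \<longrightarrow>
            positive_definite_on (st_space p \<Omega> \<Theta> N m) (st_form \<nu> \<Theta> t N m))"
proof -
  note T = \<open>time_partition T K t N m\<close> and P = \<open>partition_on \<theta> \<Theta>\<close>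
  have adm: "admissible \<theta>" using assms(3) by (rule admissible_mesh)
  have dom: "subdom \<theta> = \<Omega>" and open_dom: "open \<Omega>"
    using assms(2,3) by (auto simp: subdom_def polyhedral_domain_def fe_mesh_def)
  have sub: "\<omega> \<subseteq> \<theta>" if "\<omega> \<in> \<Theta>" for \<omega> using P that by (auto simp: partition_on_def)
  then have adm_sub: "admissible \<omega>" if "\<omega> \<in> \<Theta>" for \<omega>
    using adm admissible_subset that by blast
  have fin: "finite \<Theta>"
    using adm sub finite_subset[of \<Theta> "Pow \<theta>"] by (auto simp: admissible_def)

  have form: "\<forall>u\<in>st_space_bar p \<Omega> \<theta> K. \<forall>v\<in>st_space_bar p \<Omega> \<theta> K.
      st_form \<nu> \<Theta> t N m (st_embed \<Theta> N m u) (st_embed \<Theta> N m v) = st_form_bar \<nu> \<Omega> K t u v"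
  proof (intro ballI)
    fix u v assume "u \<in> st_space_bar p \<Omega> \<theta> K" "v \<in> st_space_bar p \<Omega> \<theta> K"
    then show "st_form \<nu> \<Theta> t N m (st_embed \<Theta> N m u) (st_embed \<Theta> N m v) = st_form_bar \<nu> \<Omega> K t u v"
      by (intro st_form_embed[OF T adm P, unfolded dom, of u p \<Omega> v] st_space_bar_fe_space)
  qed

  have load: "\<forall>v\<in>st_space_bar p \<Omega> \<theta> K.
      st_load \<Theta> t N m f (st_embed \<Theta> N m v) = st_load_bar K t fbar v"
  proof
    fix v assume "v \<in> st_space_bar p \<Omega> \<theta> K"
    then show "st_load \<Theta> t N m f (st_embed \<Theta> N m v) = st_load_bar K t fbar v"
      using assms(10) by (intro st_load_embed[OF T, of v p \<Omega> \<theta>] st_space_bar_fe_space) simp_all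
  qed

  have fe: "u n \<omega> k \<in> fe_space p \<Omega> \<omega>"
    if "u \<in> st_space p \<Omega> \<Theta> N m" "n \<in> {1..N}" "\<omega> \<in> \<Theta>" "k \<le> steps m n" for u n \<omega> k
    using that unfolding st_space_def by (simp split: if_splits)
  have init: "u n \<omega> 0 = (\<lambda>x. 0)"
    if "u \<in> st_space p \<Omega> \<Theta> N m" "\<omega> \<in> \<Theta>" "n = 1" for u n \<omega>
    using that by (simp add: st_space_def)
  have nonneg: "0 \<le> local_form \<nu> t N m n \<omega> (u n \<omega>) (u n \<omega>)"
    and zero: "local_form \<nu> t N m n \<omega> (u n \<omega>) (u n \<omega>) = 0 \<longleftrightarrow>
      (\<forall>k\<le>steps m n. u n \<omega> k = u n \<omega> 0) \<and> (n = 1 \<or> n = N \<longrightarrow> u n \<omega> 0 = (\<lambda>x. 0)) \<and>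
      (\<forall>C\<in>components (patch \<omega>). u n \<omega> 0 constant_on C)"
    if u: "u \<in> st_space p \<Omega> \<Theta> N m" and n: "n \<in> {1..N}" and \<omega>: "\<omega> \<in> \<Theta>" for u n \<omega>
    using local_form_definite[where u = "u n \<omega>" and m = m and n = n and t = t and N = N,
        OF adm_sub[OF \<omega>] fe[OF u n \<omega>] local_time_index(2)[OF T n]
        \<open>0 < \<nu>\<close> local_time_pos[OF T n] init[OF u \<omega>]] by blast+

  have psd: "0 \<le> st_form \<nu> \<Theta> t N m u u" if "u \<in> st_space p \<Omega> \<Theta> N m" for u
    unfolding st_form_def by (intro sum_nonneg nonneg that)

  have kernel: "st_form \<nu> \<Theta> t N m u u = 0 \<longleftrightarrow> u \<in> floating_modes p \<Omega> \<Theta> N m"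
    if u: "u \<in> st_space p \<Omega> \<Theta> N m" for u
  proof -
    let ?l = "\<lambda>n \<omega>. local_form \<nu> t N m n \<omega> (u n \<omega>) (u n \<omega>)"
    have "st_form \<nu> \<Theta> t N m u u = 0 \<longleftrightarrow> (\<forall>n\<in>{1..N}. (\<Sum>\<omega>\<in>\<Theta>. ?l n \<omega>) = 0)"
      unfolding st_form_def
      by (rule sum_nonneg_eq_0_iff) (auto intro!: sum_nonneg nonneg[OF u])
    also have "\<dots> \<longleftrightarrow> (\<forall>n\<in>{1..N}. \<forall>\<omega>\<in>\<Theta>. ?l n \<omega> = 0)"
      by (intro ball_cong refl sum_nonneg_eq_0_iff[OF fin] nonneg[OF u])
    also have "\<dots> \<longleftrightarrow> u \<in> floating_modes p \<Omega> \<Theta> N m"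
      unfolding floating_modes_iff[OF T u] by (intro ball_cong refl zero[OF u])
    finally show ?thesis .
  qed

  have trivial: "u = (\<lambda>n \<omega> k x. 0)"
    if u: "u \<in> floating_modes p \<Omega> \<Theta> N m" and rigid: "N \<le> 2 \<or> (\<forall>\<omega>\<in>\<Theta>. non_floating \<Omega> \<omega>)" for u
  proof -
    have st: "u \<in> st_space p \<Omega> \<Theta> N m" using u by (simp add: floating_modes_def)
    have start: "u n \<omega> 0 = (\<lambda>x. 0)" if n: "n \<in> {1..N}" and \<omega>: "\<omega> \<in> \<Theta>" for n \<omega>
    proof (cases "n = 1 \<or> n = N")
      case True
      then show ?thesis using u n \<omega> unfolding floating_modes_def by blast
    next
      case False
      then have "non_floating \<Omega> \<omega>" using rigid n \<omega> by auto
      moreover have "u n \<omega> 0 constant_on C" if "C \<in> components (patch \<omega>)" for C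
        using u n \<omega> that unfolding floating_modes_def by blast
      moreover have "subdom \<omega> \<subseteq> \<Omega>"
        unfolding dom[symmetric] subdom_def patch_def using sub[OF \<omega>] by (intro interior_mono UN_mono) auto
      ultimately show ?thesis
        using non_floating_const_imp_zero[OF adm_sub[OF \<omega>] fe[OF st n \<omega>]] open_dom by blast
    qed
    have "u n \<omega> k = (\<lambda>x. 0)" for n \<omega> k
    proof (cases "n \<in> {1..N} \<and> \<omega> \<in> \<Theta> \<and> k \<le> steps m n")
      case True
      then have "u n \<omega> k = u n \<omega> 0" using u unfolding floating_modes_def by blast
      then show ?thesis using start True by simp
    next
      case False
      then show ?thesis using st unfolding st_space_def by (simp split: if_splits)
    qed
    then show ?thesis by (intro ext) simp
  qed

  have pd: "positive_definite_on (st_space p \<Omega> \<Theta> N m) (st_form \<nu> \<Theta> t N m)"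
    if rigid: "N \<le> 2 \<or> (\<forall>\<omega>\<in>\<Theta>. non_floating \<Omega> \<omega>)"
    unfolding positive_definite_on_def
  proof (intro ballI impI)
    fix u assume u: "u \<in> st_space p \<Omega> \<Theta> N m" and "u \<noteq> (\<lambda>n \<omega> k x. 0)"
    then have "st_form \<nu> \<Theta> t N m u u \<noteq> 0" using kernel[OF u] trivial rigid by blast
    then show "0 < st_form \<nu> \<Theta> t N m u u" using psd[OF u] by linarith
  qed
  show ?thesis using form load psd kernel pd by blast
qed

end
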